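(* There exists a trigonometric series $\sum_{n=-\infty}^{\infty} c(n)e^{int}$ on the circle $\mathbb{T}=\mathbb{R}/2\pi\mathbb{Z}$, with not all $c(n)$ equal to zero, whose symmetric partial sums $\sum_{|n|\le N} c(n)e^{int}$ converge to $0$ as $N\to\infty$ for almost every $t\in\mathbb{T}$, and whose coefficients with negative index satisfy, for every $k=1,2,\dots$, $c(n)=O(|n|^{-k})$ as $n\to-\infty$.
   Context: A trigonometric series $\sum_{n\in\mathbb{Z}} c(n)e^{int}$ is called a null-series if its symmetric partial sums converge to zero almost everywhere on $\mathbb{T}$. The series is nontrivial if some $c(n)\neq 0$. *)

theory Defs
  imports "HOL-Analysis.Analysis"
begin

definition null_series :: "(int \<Rightarrow> complex) \<Rightarrow> bool" where
  "null_series c \<longleftrightarrow>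
     (AE t in lborel. ((\<lambda>N::nat. \<Sum>n\<in>{-int N..int N}. c n * exp (\<i> * of_int n * of_real t))
        \<longlongrightarrow> 0) sequentially)"

end

theory Submission
  imports Defs "HOL-Complex_Analysis.Cauchy_Integral_Formula"
begin

text \<open>
  Starting from \<open>S\<^sub>0 = 1\<close>, put \<open>S\<^sub>j\<^sub>+\<^sub>1 = S\<^sub>j u(B)\<close> with \<open>B(t) = M\<^sup>2 t + M sin t + \<theta>\<close> and \<open>u = w\<^sup>L (1 - b)\<close>.
  Here \<open>w(x) = (1 - z) / (1 - (1 - D) z)\<close> with \<open>z = e\<^sup>i\<^sup>x\<close> extends analytically to the disc with value \<open>1\<close> at the
  origin, has modulus at most \<open>1/2\<close> on an arc of length of order \<open>D\<close> around \<open>0\<close>, and is nowhere larger than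
  \<open>1 + D\<close>; the bump \<open>b\<close> lives on that arc, so that \<open>S\<^sub>j\<^sub>+\<^sub>1\<close> vanishes on a fixed proportion (of order \<open>D\<close>) of the
  set where \<open>S\<^sub>j\<close> does not. The chirp \<open>M sin t\<close> makes all coefficients of \<open>e\<^sup>i\<^sup>k\<^sup>B\<close>, \<open>k \<ge> 1\<close>, of size \<open>M\<^sup>-\<^sup>1\<^sup>/\<^sup>4\<close>
  (van der Corput), while its negative coefficients are negligible because \<open>M\<^sup>2 \<gg> M\<close>. Since \<open>w\<^sup>L\<close> grows only like
  \<open>(1 + D)\<^sup>L\<close> and the correction \<open>w\<^sup>L b\<close> is of size \<open>2\<^sup>-\<^sup>L\<close>, one can take \<open>L\<close> a large multiple of \<open>log M\<close>, with \<open>D\<close>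
  the reciprocal of that multiple: then \<open>(1 + D)\<^sup>L\<close> loses against \<open>M\<^sup>1\<^sup>/\<^sup>4\<close> and \<open>2\<^sup>-\<^sup>L\<close> wins against any prescribed power
  of \<open>M\<close>. At stage \<open>j\<close> the multiple is of order \<open>j\<close>, so \<open>\<Sum> D = \<infinity>\<close> and the supports shrink to a null set.
  The coefficients converge uniformly to some \<open>c\<close> tending to \<open>0\<close>, and off the limiting support the partial sums
  converge to \<open>0\<close> by Riemann localisation: there \<open>S\<^sub>j(t) / (1 - exp(i(t - t\<^sub>0)))\<close> is still of class \<open>C\<^sup>1\<close>, which makes the
  partial sum at \<open>t\<^sub>0\<close> telescope to two coefficients of this quotient.
\<close>

section \<open>Smooth functions of a real variable\<close>

text \<open>The derivative is an existential witness at each order, so closure properties go by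
  induction on the order with the usual derivative formula as witness.\<close>

primrec Ck :: "nat \<Rightarrow> (real \<Rightarrow> 'a::real_normed_vector) \<Rightarrow> bool" where
  "Ck 0 f \<longleftrightarrow> continuous_on UNIV f"
| "Ck (Suc n) f \<longleftrightarrow> (\<exists>f'. (\<forall>x. (f has_vector_derivative f' x) (at x)) \<and> Ck n f')"

definition smooth :: "(real \<Rightarrow> 'a::real_normed_vector) \<Rightarrow> bool" where
  "smooth f \<longleftrightarrow> (\<forall>n. Ck n f)"

lemma continuous_on_UNIV_if_deriv:
  fixes f :: "real \<Rightarrow> 'a::real_normed_vector"
  assumes "\<And>x. (f has_vector_derivative f' x) (at x)"
  shows "continuous_on UNIV f"
  using assms by (meson continuous_at_imp_continuous_on has_vector_derivative_continuous)

lemma Ck_SucI: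
  assumes "\<forall>x. (f has_vector_derivative f' x) (at x)" "Ck n f'"
  shows "Ck (Suc n) f"
  using assms by auto

lemma Ck_imp_continuous: "Ck n f \<Longrightarrow> continuous_on UNIV f"
  by (cases n) (auto intro: continuous_on_UNIV_if_deriv)

lemma Ck_SucD: "Ck (Suc n) f \<Longrightarrow> Ck n f"
proof (induction n arbitrary: f)
  case 0
  then show ?case using Ck_imp_continuous[of "Suc 0" f] by simp
next
  case (Suc n)
  then show ?case by (metis Ck.simps(2))
qed

lemma Ck_const: "Ck n (\<lambda>_. c)"
proof (induction n arbitrary: c)
  case (Suc n)
  have "\<forall>x. ((\<lambda>_. c) has_vector_derivative 0) (at x)" by simp
  then show ?case by (rule Ck_SucI) (rule Suc)
qed simp

lemma Ck_ident: "Ck n (\<lambda>x. x)"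
proof (cases n)
  case (Suc m)
  have "\<forall>x::real. ((\<lambda>x. x) has_vector_derivative 1) (at x)" by simp
  then show ?thesis unfolding Suc by (rule Ck_SucI) (rule Ck_const)
qed simp

lemma Ck_linear:
  assumes "bounded_linear h"
  shows "Ck n f \<Longrightarrow> Ck n (\<lambda>x. h (f x))"
proof (induction n arbitrary: f)
  case 0
  then show ?case using assms by (auto intro: bounded_linear.continuous_on)
next
  case (Suc n)
  then obtain f' where f': "\<forall>x. (f has_vector_derivative f' x) (at x)" "Ck n f'" by auto
  have "\<forall>x. ((\<lambda>x. h (f x)) has_vector_derivative h (f' x)) (at x)"
    using f' assms by (auto intro: bounded_linear.has_vector_derivative)
  then show ?case using Suc.IH[OF f'(2)] by auto
qed

lemma Ck_add: "Ck n f \<Longrightarrow> Ck n g \<Longrightarrow> Ck n (\<lambda>x. f x + g x)"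
proof (induction n arbitrary: f g)
  case 0
  then show ?case by (auto intro: continuous_intros)
next
  case (Suc n)
  then obtain f' g' where d: "\<forall>x. (f has_vector_derivative f' x) (at x)" "Ck n f'"
    "\<forall>x. (g has_vector_derivative g' x) (at x)" "Ck n g'" by auto
  have "\<forall>x. ((\<lambda>x. f x + g x) has_vector_derivative (f' x + g' x)) (at x)"
    using d by (auto intro: has_vector_derivative_add)
  then show ?case using Suc.IH[OF d(2,4)] by auto
qed

text \<open>An arbitrary bounded bilinear product lets one product rule serve both multiplication
  and real scaling; the chain rule below produces the latter.\<close>

lemma Ck_bilinear:
  assumes "bounded_bilinear pr"
  shows "Ck n f \<Longrightarrow> Ck n g \<Longrightarrow> Ck n (\<lambda>x. pr (f x) (g x))"
proof (induction n arbitrary: f g)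
  case 0
  then show ?case using assms by (auto intro: bounded_bilinear.continuous_on)
next
  case (Suc n)
  then obtain f' g' where d: "\<forall>x. (f has_vector_derivative f' x) (at x)" "Ck n f'"
    "\<forall>x. (g has_vector_derivative g' x) (at x)" "Ck n g'" by auto
  have "\<forall>x. ((\<lambda>x. pr (f x) (g x)) has_vector_derivative (pr (f x) (g' x) + pr (f' x) (g x))) (at x)"
    using d by (auto intro: bounded_bilinear.has_vector_derivative[OF assms])
  moreover have "Ck n (\<lambda>x. pr (f x) (g' x) + pr (f' x) (g x))"
    using d Ck_SucD[OF Suc.prems(1)] Ck_SucD[OF Suc.prems(2)] by (intro Ck_add Suc.IH)
  ultimately show ?case by auto
qed

lemmas Ck_mult = Ck_bilinear[OF bounded_bilinear_mult]
lemmas Ck_scaleR = Ck_bilinear[OF bounded_bilinear_scaleR]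

lemma Ck_compose:
  "Ck n g \<Longrightarrow> Ck n h \<Longrightarrow> Ck n (\<lambda>x. g (h x))"
proof (induction n arbitrary: g)
  case 0
  then show ?case by (auto intro: continuous_on_compose2)
next
  case (Suc n)
  then obtain g' h' where d: "\<forall>x. (g has_vector_derivative g' x) (at x)" "Ck n g'"
    "\<forall>x. (h has_vector_derivative h' x) (at x)" "Ck n h'" by auto
  have "\<forall>x. ((\<lambda>x. g (h x)) has_vector_derivative (h' x *\<^sub>R g' (h x))) (at x)"
    using d vector_diff_chain_at[of h _ _ g, unfolded o_def] by blast
  moreover have "Ck n (\<lambda>x. h' x *\<^sub>R g' (h x))"
    using d Ck_SucD[OF Suc.prems(2)] by (intro Ck_scaleR Suc.IH)
  ultimately show ?case by auto
qed

lemma Ck_inverse: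
  fixes f :: "real \<Rightarrow> 'a::real_normed_field"
  assumes nz: "\<And>x. f x \<noteq> 0"
  shows "Ck n f \<Longrightarrow> Ck n (\<lambda>x. inverse (f x))"
proof (induction n)
  case 0
  then show ?case using nz by (auto intro: continuous_on_inverse)
next
  case (Suc n)
  then obtain f' where d: "\<forall>x. (f has_vector_derivative f' x) (at x)" "Ck n f'" by auto
  have "\<forall>x. ((\<lambda>x. inverse (f x)) has_vector_derivative (- 1 * (inverse (f x) * f' x * inverse (f x)))) (at x)"
  proof
    fix x
    have "((\<lambda>x. inverse (f x)) has_derivative (\<lambda>h. - (inverse (f x) * (h *\<^sub>R f' x) * inverse (f x)))) (at x)"
      using d nz Deriv.has_derivative_inverse[where f = f and x = x and f' = "\<lambda>h. h *\<^sub>R f' x"] by (auto simp: has_vector_derivative_def)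
    then show "((\<lambda>x. inverse (f x)) has_vector_derivative (- 1 * (inverse (f x) * f' x * inverse (f x)))) (at x)"
      unfolding has_vector_derivative_def by (rule has_derivative_eq_rhs) (auto simp: fun_eq_iff)
  qed
  moreover have "Ck n (\<lambda>x. - 1 * (inverse (f x) * f' x * inverse (f x)))"
    using Ck_SucD[OF Suc.prems] d Suc.IH by (intro Ck_mult Ck_const)
  ultimately show ?case by auto
qed

lemma smooth_const: "smooth (\<lambda>_. c)" by (simp add: smooth_def Ck_const)
lemma smooth_ident: "smooth (\<lambda>x. x)" by (simp add: smooth_def Ck_ident)
lemma smooth_add: "smooth f \<Longrightarrow> smooth g \<Longrightarrow> smooth (\<lambda>x. f x + g x)" by (simp add: smooth_def Ck_add)
lemma smooth_mult:
  fixes f g :: "real \<Rightarrow> 'a::real_normed_algebra"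
  shows "smooth f \<Longrightarrow> smooth g \<Longrightarrow> smooth (\<lambda>x. f x * g x)" by (simp add: smooth_def Ck_mult)
lemma smooth_compose: "smooth g \<Longrightarrow> smooth h \<Longrightarrow> smooth (\<lambda>x. g (h x))" by (simp add: smooth_def Ck_compose)
lemma smooth_of_real: "smooth f \<Longrightarrow> smooth (\<lambda>x. complex_of_real (f x))"
  by (simp add: smooth_def Ck_linear[OF bounded_linear_of_real])
lemma smooth_inverse:
  fixes f :: "real \<Rightarrow> 'a::real_normed_field"
  shows "(\<And>x. f x \<noteq> 0) \<Longrightarrow> smooth f \<Longrightarrow> smooth (\<lambda>x. inverse (f x))" by (simp add: smooth_def Ck_inverse)
lemma smooth_minus: "smooth f \<Longrightarrow> smooth (\<lambda>x. - f x)"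
  by (simp add: smooth_def Ck_linear[OF bounded_linear_minus[OF bounded_linear_ident]])
lemma smooth_diff: "smooth f \<Longrightarrow> smooth g \<Longrightarrow> smooth (\<lambda>x. f x - g x)"
  using smooth_add[OF _ smooth_minus, of f g] by simp
lemma smooth_power:
  fixes f :: "real \<Rightarrow> 'a::real_normed_field"
  shows "smooth f \<Longrightarrow> smooth (\<lambda>x. f x ^ n)"
  by (induction n) (auto intro: smooth_mult smooth_const)

lemma smooth_cis: "smooth cis"
proof -
  have "Ck n (\<lambda>x. c * cis x)" for n c
  proof (induction n arbitrary: c)
    case 0
    then show ?case by (auto intro!: continuous_intros)
  next
    case (Suc n)
    have "\<forall>x. ((\<lambda>x. c * cis x) has_vector_derivative (c * \<i> * cis x)) (at x)"
      unfolding has_vector_derivative_def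
      by (auto intro!: derivative_eq_intros)
    then show ?case using Suc[of "c * \<i>"] by auto
  qed
  from this[of _ 1] show ?thesis by (simp add: smooth_def)
qed

lemma smooth_sin: "smooth (sin :: real \<Rightarrow> real)" and smooth_cos: "smooth (cos :: real \<Rightarrow> real)"
  using Ck_linear[OF bounded_linear_Im] Ck_linear[OF bounded_linear_Re] smooth_cis
  unfolding smooth_def by fastforce+

lemmas smooth_intros = smooth_const smooth_ident smooth_add smooth_mult smooth_of_real
  smooth_minus smooth_diff smooth_power smooth_compose[OF smooth_cis]
  smooth_compose[OF smooth_sin] smooth_compose[OF smooth_cos]

lemma smooth_deriv:
  assumes "smooth f"
  obtains f' where "\<And>x. (f has_vector_derivative f' x) (at x)" "smooth f'"
proof -
  have "Ck (Suc 0) f" using assms by (simp add: smooth_def)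
  then obtain f' where f': "\<forall>x. (f has_vector_derivative f' x) (at x)" by auto
  \<comment> \<open>The order-one derivative is fixed once; uniqueness of derivatives identifies it
    with the witness hidden in every higher order.\<close>
  have "Ck n f'" for n
  proof -
    have "Ck (Suc n) f" using assms by (simp add: smooth_def)
    then obtain g where g: "\<forall>x. (f has_vector_derivative g x) (at x)" "Ck n g" by auto
    have "g = f'" using f' g vector_derivative_unique_at by (metis ext)
    then show ?thesis using g by simp
  qed
  then show ?thesis using that f' by (auto simp: smooth_def)
qed

lemma smooth_imp_continuous: "smooth f \<Longrightarrow> continuous_on S f"
  unfolding smooth_def using Ck_imp_continuous continuous_on_subset by blast

subsection \<open>Bump functions\<close>

text \<open>The classical flat function is the case \<open>k = 0\<close>. Negative powers of
  \<open>x\<close> are included because the resulting family has derivatives in its own linear span,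
  which makes smoothness an induction.\<close>

definition flat :: "nat \<Rightarrow> real \<Rightarrow> real" where
  "flat k x = (if x > 0 then (1 / x) ^ k * exp (- (1 / x)) else 0)"

lemma flat_tendsto_0: "(flat k \<longlongrightarrow> 0) (at_right 0)"
proof -
  have "((\<lambda>x. x ^ k / exp x) \<longlongrightarrow> (0::real)) at_top" by (rule tendsto_power_div_exp_0)
  then have "((\<lambda>x. (inverse x) ^ k / exp (inverse x)) \<longlongrightarrow> (0::real)) (at_right 0)"
    by (rule filterlim_compose) (rule filterlim_inverse_at_top_right)
  moreover have "\<forall>\<^sub>F x in at_right 0. (inverse x) ^ k / exp (inverse x) = flat k x"
    by (auto simp: eventually_at_right_less flat_def exp_minus field_simps
        intro!: eventually_mono[OF eventually_at_right_less[of 0]])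
  ultimately show ?thesis by (rule Lim_transform_eventually)
qed

lemma flat_deriv:
  "(flat k has_vector_derivative (- real k * flat (Suc k) x + flat (Suc (Suc k)) x)) (at x)"
proof -
  consider "x > 0" | "x < 0" | "x = 0" by linarith
  then show ?thesis
  proof cases
    case 1
    have "((\<lambda>x. (1 / x) ^ k * exp (- (1 / x))) has_real_derivative
       (- real k * flat (Suc k) x + flat (Suc (Suc k)) x)) (at x)"
    proof -
      have d: "((\<lambda>x. 1 / x) has_real_derivative - ((1 / x)\<^sup>2)) (at x)"
        using 1 by (auto intro!: derivative_eq_intros simp: power2_eq_square)
      have e: "real k * (1 / x) ^ (k - Suc 0) * (1 / x)\<^sup>2 = real k * (1 / x) ^ Suc k"
        by (cases k) (auto simp: power2_eq_square)
      have "real k * (- ((1 / x)\<^sup>2) * (1 / x) ^ (k - Suc 0)) * exp (- (1 / x)) +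
          exp (- (1 / x)) * - (- ((1 / x)\<^sup>2)) * (1 / x) ^ k =
          - (real k * (1 / x) ^ (k - Suc 0) * (1 / x)\<^sup>2) * exp (- (1 / x)) + (1 / x) ^ Suc (Suc k) * exp (- (1 / x))"
        by (simp add: power2_eq_square)
      also have "\<dots> = - real k * flat (Suc k) x + flat (Suc (Suc k)) x"
        unfolding e using 1 by (simp add: flat_def)
      finally show ?thesis
        using DERIV_mult[OF DERIV_power[OF d, of k] DERIV_chain2[OF DERIV_exp DERIV_minus[OF d]]]
        by (simp add: mult.commute mult.left_commute)
    qed
    then have "((\<lambda>x. (1 / x) ^ k * exp (- (1 / x))) has_vector_derivative
       (- real k * flat (Suc k) x + flat (Suc (Suc k)) x)) (at x)"
      by (simp add: has_real_derivative_iff_has_vector_derivative)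
    then show ?thesis
      by (rule has_vector_derivative_transform_within_open[of _ _ _ "{0<..}"])
        (use 1 in \<open>auto simp: flat_def\<close>)
  next
    case 2
    have "((\<lambda>x. 0::real) has_vector_derivative (- real k * flat (Suc k) x + flat (Suc (Suc k)) x)) (at x)"
      using 2 by (auto simp: flat_def)
    then show ?thesis
      by (rule has_vector_derivative_transform_within_open[of _ _ _ "{..<0}"])
        (use 2 in \<open>auto simp: flat_def\<close>)
  next
    case 3
    \<comment> \<open>To the right of 0 the difference quotient is \<open>flat (Suc k)\<close>,
      whose limit is known; to the left it is identically 0.\<close>
    have "((\<lambda>y. (flat k y - flat k 0) / (y - 0)) \<longlongrightarrow> 0) (at 0)"
      unfolding filterlim_at_split
    proof
      show "((\<lambda>y. (flat k y - flat k 0) / (y - 0)) \<longlongrightarrow> 0) (at_right 0)"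
        by (rule Lim_transform_eventually[OF flat_tendsto_0[of "Suc k"]])
          (auto intro!: eventually_mono[OF eventually_at_right_less[of 0]] simp: flat_def)
      show "((\<lambda>y. (flat k y - flat k 0) / (y - 0)) \<longlongrightarrow> 0) (at_left 0)"
        by (rule Lim_transform_eventually[OF tendsto_const[of 0]])
          (auto simp: flat_def eventually_at_filter)
    qed
    then have "(flat k has_real_derivative 0) (at 0)"
      by (simp add: has_field_derivative_iff)
    then show ?thesis using 3 by (simp add: has_real_derivative_iff_has_vector_derivative flat_def)
  qed
qed

lemma smooth_flat: "smooth (flat k)"
proof -
  have "Ck n (flat k)" for n
  proof (induction n arbitrary: k)
    case 0
    then show ?case using continuous_on_UNIV_if_deriv[OF flat_deriv] by simp
  next
    case (Suc n)
    have "Ck n (\<lambda>x. - real k * flat (Suc k) x + flat (Suc (Suc k)) x)"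
      by (intro Ck_add Ck_mult Ck_const Suc)
    then show ?case using flat_deriv by (intro Ck_SucI) auto
  qed
  then show ?thesis by (simp add: smooth_def)
qed

text \<open>A smooth step from 0 to 1, obtained by composing \<open>flat 0\<close> with itself: the
  inner value reaches \<open>exp (- 1)\<close> at \<open>y = 1\<close>, and from there on the outer
  \<open>flat 0\<close> sees a nonpositive argument.\<close>

definition bump :: "real \<Rightarrow> real" where
  "bump y = 1 - flat 0 (exp (- 1) - flat 0 y) / flat 0 (exp (- 1))"

lemma smooth_bump: "smooth bump"
  unfolding bump_def [abs_def] divide_inverse
  by (intro smooth_intros smooth_compose[OF smooth_flat] smooth_flat)

lemma bump_eq_0: "y \<le> 0 \<Longrightarrow> bump y = 0"
  by (auto simp: bump_def flat_def)

lemma bump_eq_1: "y \<ge> 1 \<Longrightarrow> bump y = 1"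
  by (auto simp: bump_def flat_def)

section \<open>Fourier coefficients of periodic functions\<close>

definition periodic :: "(real \<Rightarrow> 'a) \<Rightarrow> bool" where
  "periodic f \<longleftrightarrow> (\<forall>t. f (t + 2 * pi) = f t)"

definition psmooth :: "(real \<Rightarrow> complex) \<Rightarrow> bool" where
  "psmooth f \<longleftrightarrow> smooth f \<and> periodic f"

lemma periodic_int:
  assumes "periodic f"
  shows "f (t + 2 * pi * of_int k) = f t"
proof -
  have nat: "f (t + 2 * pi * of_nat n) = f t" for t n
  proof (induction n)
    case (Suc n)
    have "f (t + 2 * pi * of_nat (Suc n)) = f (t + 2 * pi * of_nat n + 2 * pi)"
      by (simp add: algebra_simps)
    then show ?case using Suc assms by (simp add: periodic_def)
  qed simp
  show ?thesis
  proof (cases "k \<ge> 0")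
    case True
    then show ?thesis using nat[of t "nat k"] by simp
  next
    case False
    then show ?thesis using nat[of "t + 2 * pi * of_int k" "nat (- k)"] by simp
  qed
qed

lemma ex_shift_into_period:
  obtains k :: int where "t - 2 * pi * of_int k \<in> {0..2 * pi}"
proof -
  define x where "x = t / (2 * pi)"
  have t: "t = 2 * pi * x" by (simp add: x_def)
  have "0 \<le> x - of_int \<lfloor>x\<rfloor>" "x - of_int \<lfloor>x\<rfloor> \<le> 1" by linarith+
  then have "0 \<le> 2 * pi * (x - of_int \<lfloor>x\<rfloor>)" "2 * pi * (x - of_int \<lfloor>x\<rfloor>) \<le> 2 * pi * 1"
    using mult_left_mono[of "x - of_int \<lfloor>x\<rfloor>" 1 "2 * pi"] by simp_all
  then have "t - 2 * pi * of_int \<lfloor>x\<rfloor> \<in> {0..2 * pi}" by (simp add: t right_diff_distrib)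
  then show ?thesis using that by blast
qed

lemma periodic_bounded:
  fixes f :: "real \<Rightarrow> complex"
  assumes "continuous_on UNIV f" "periodic f"
  obtains K where "K > 0" "\<And>t. norm (f t) \<le> K"
proof -
  have "compact (f ` {0..2 * pi})"
    using assms continuous_on_subset by (blast intro: compact_continuous_image)
  then obtain K where K: "K > 0" "\<And>t. t \<in> {0..2*pi} \<Longrightarrow> norm (f t) \<le> K"
    using compact_imp_bounded by (metis bounded_pos imageI)
  have "norm (f t) \<le> K" for t
  proof -
    obtain k :: int where k: "t - 2 * pi * of_int k \<in> {0..2 * pi}" by (rule ex_shift_into_period)
    have "f t = f (t - 2 * pi * of_int k)"
      using periodic_int[OF assms(2), of "t - 2 * pi * of_int k" k] by simp
    then show ?thesis using K(2)[OF k] by simp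
  qed
  with K(1) that show ?thesis by blast
qed

lemma periodic_deriv:
  fixes f :: "real \<Rightarrow> 'a::real_normed_vector"
  assumes "periodic f" "\<And>x. (f has_vector_derivative f' x) (at x)"
  shows "periodic f'"
  unfolding periodic_def
proof
  fix t
  have "(f \<circ> (\<lambda>t. t + 2 * pi) has_vector_derivative 1 *\<^sub>R f' (t + 2 * pi)) (at t)"
    by (rule vector_diff_chain_at) (auto intro!: derivative_eq_intros assms)
  moreover have "f \<circ> (\<lambda>t. t + 2 * pi) = f" using assms(1) by (auto simp: periodic_def)
  ultimately show "f' (t + 2 * pi) = f' t"
    using vector_derivative_unique_at[OF _ assms(2)[of t], of "f' (t + 2 * pi)"] by simp
qed

lemma psmooth_deriv:
  assumes "psmooth f"
  obtains f' where "\<And>x. (f has_vector_derivative f' x) (at x)" "psmooth f'"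
proof -
  obtain f' where "\<And>x. (f has_vector_derivative f' x) (at x)" "smooth f'"
    using assms smooth_deriv unfolding psmooth_def by blast
  then show ?thesis using assms periodic_deriv[of f f'] that unfolding psmooth_def by blast
qed

lemma psmooth_bounded:
  assumes "psmooth f"
  obtains K where "K > 0" "\<And>t. norm (f t) \<le> K"
  using periodic_bounded[of f] smooth_imp_continuous[of f UNIV] assms unfolding psmooth_def by blast

lemma psmooth_mult: "psmooth f \<Longrightarrow> psmooth g \<Longrightarrow> psmooth (\<lambda>t. f t * g t)"
  by (simp add: psmooth_def periodic_def smooth_mult)

lemma psmooth_diff: "psmooth f \<Longrightarrow> psmooth g \<Longrightarrow> psmooth (\<lambda>t. f t - g t)"
  by (simp add: psmooth_def periodic_def smooth_diff)

lemma psmooth_const: "psmooth (\<lambda>_. c)"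
  by (simp add: psmooth_def periodic_def smooth_const)

lemma psmooth_power: "psmooth f \<Longrightarrow> psmooth (\<lambda>t. f t ^ n)"
  by (simp add: psmooth_def periodic_def smooth_power)

lemma psmooth_cos: "psmooth (\<lambda>t. complex_of_real (cos t))"
  by (simp add: psmooth_def periodic_def smooth_of_real smooth_cos)

text \<open>Fourier coefficients without the factor 1/(2 pi): a common scalar changes neither
  convergence to 0 nor rates of decay.\<close>

definition fc :: "(real \<Rightarrow> complex) \<Rightarrow> int \<Rightarrow> complex" where
  "fc f n = integral {0..2 * pi} (\<lambda>t. f t * cis (- (real_of_int n * t)))"

lemma fc_integrable:
  assumes "continuous_on UNIV f"
  shows "(\<lambda>t. f t * cis (- (real_of_int n * t))) integrable_on {0..2 * pi}"
  by (intro integrable_continuous_interval continuous_intros continuous_on_subset[OF assms]) auto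

lemma fc_norm_le:
  assumes "continuous_on UNIV f" "\<And>t. norm (f t) \<le> K"
  shows "norm (fc f n) \<le> 2 * pi * K"
proof -
  have "norm (fc f n) \<le> K * (2 * pi - 0)"
    unfolding fc_def
    by (rule integral_bound)
      (auto intro!: continuous_intros continuous_on_subset[OF assms(1)] simp: norm_mult assms(2))
  then show ?thesis by (simp add: mult.commute)
qed

lemma fc_add:
  assumes "continuous_on UNIV f" "continuous_on UNIV g"
  shows "fc (\<lambda>t. f t + g t) n = fc f n + fc g n"
  unfolding fc_def using integral_add[OF assms[THEN fc_integrable]] by (simp add: algebra_simps)

lemma fc_diff:
  assumes "continuous_on UNIV f" "continuous_on UNIV g"
  shows "fc (\<lambda>t. f t - g t) n = fc f n - fc g n"
  unfolding fc_def using integral_diff[OF assms[THEN fc_integrable]] by (simp add: algebra_simps)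

lemma fc_cmult: "fc (\<lambda>t. c * f t) n = c * fc f n"
  unfolding fc_def by (simp add: mult.assoc)

lemma fc_cis: "fc (\<lambda>t. cis (of_int k * t) * f t) n = fc f (n - k)"
proof -
  have "cis (of_int k * t) * f t * cis (- (of_int n * t)) = f t * cis (- (of_int (n - k) * t))" for t
  proof -
    have "cis (of_int k * t) * f t * cis (- (of_int n * t)) = f t * (cis (of_int k * t) * cis (- (of_int n * t)))" by simp
    also have "\<dots> = f t * cis (- (of_int (n - k) * t))"
      unfolding cis_mult by (simp add: algebra_simps)
    finally show ?thesis .
  qed
  then show ?thesis unfolding fc_def by presburger
qed

lemma cis_int_2pi: "cis (2 * pi * of_int k) = 1"
  by (simp add: cis_multiple_2pi)

lemma has_vector_derivative_cis:
  assumes "(g has_real_derivative g') (at x within A)"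
  shows "((\<lambda>x. cis (g x)) has_vector_derivative (\<i> * of_real g' * cis (g x))) (at x within A)"
proof -
  have "((\<lambda>x. cis (g x)) has_derivative (\<lambda>t. (g' * t) *\<^sub>R (\<i> * cis (g x)))) (at x within A)"
    using assms by (intro has_derivative_cis) (simp add: has_field_derivative_def mult_commute_abs)
  then show ?thesis
    unfolding has_vector_derivative_def
    by (rule has_derivative_eq_rhs) (auto simp: fun_eq_iff scaleR_conv_of_real)
qed

section \<open>Integration by parts and decay of Fourier coefficients\<close>

lemma integral_periodic_deriv:
  assumes "\<And>t. (h has_vector_derivative h' t) (at t)" "h (2 * pi) = (h 0 :: complex)"
  shows "integral {0..2 * pi} h' = 0"
proof -
  have "(h' has_integral (h (2 * pi) - h 0)) {0..2 * pi}"
    using assms(1) by (intro fundamental_theorem_of_calculus) (auto intro: has_vector_derivative_at_within)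
  then show ?thesis using assms(2) by (simp add: integral_unique)
qed

lemma fc_deriv:
  assumes "periodic f" "\<And>t. (f has_vector_derivative f' t) (at t)" "continuous_on UNIV f'"
  shows "fc f' n = \<i> * of_int n * fc f n"
proof -
  define h where "h t = f t * cis (- (real_of_int n * t))" for t
  have cf: "continuous_on UNIV f" using continuous_on_UNIV_if_deriv assms(2) by blast
  have "(h has_vector_derivative (f' t * cis (- (real_of_int n * t)) - \<i> * of_int n * (f t * cis (- (real_of_int n * t))))) (at t)" for t
    unfolding h_def
    by (rule derivative_eq_intros assms(2) has_vector_derivative_cis refl)+ (auto simp: algebra_simps)
  moreover have "h (2 * pi) = h 0"
  proof -
    have "f (2 * pi) = f 0" using assms(1) unfolding periodic_def by (metis add_0)
    moreover have "- (real_of_int n * (2 * pi)) = 2 * pi * of_int (- n)" by simp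
    ultimately show ?thesis unfolding h_def using cis_int_2pi[of "- n"] by (simp only: mult_zero_right minus_zero cis_zero)
  qed
  ultimately have "integral {0..2*pi} (\<lambda>t. f' t * cis (- (real_of_int n * t)) - \<i> * of_int n * (f t * cis (- (real_of_int n * t)))) = 0"
    by (rule integral_periodic_deriv)
  moreover have "integral {0..2*pi} (\<lambda>t. f' t * cis (- (real_of_int n * t)) - \<i> * of_int n * (f t * cis (- (real_of_int n * t)))) = fc f' n - \<i> * of_int n * fc f n"
    using integral_diff[OF fc_integrable[OF assms(3), of n] integrable_on_mult_right[OF fc_integrable[OF cf, of n], of "\<i> * of_int n"]]
    unfolding fc_def by simp
  ultimately show ?thesis by simp
qed

text \<open>Integrate by parts \<open>a\<close> times. A derivative falls either on the amplitude or
  on the chirp, and the chirp costs a factor \<open>x\<close> while turning \<open>S\<close> into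
  another smooth amplitude. The constant depends on \<open>S\<close> and \<open>a\<close>
  only.\<close>

lemma fc_phase_decay:
  assumes "psmooth S"
  shows "\<exists>C\<ge>0. \<forall>x\<ge>0. \<forall>p. \<bar>of_int p\<bar> ^ a * norm (fc (\<lambda>t. S t * cis (x * sin t)) p) \<le> C * (1 + x) ^ a"
  using assms
proof (induction a arbitrary: S)
  case 0
  obtain K where K: "K > 0" "\<And>t. norm (S t) \<le> K" by (rule psmooth_bounded[OF 0]) blast
  have "continuous_on UNIV S" using 0 smooth_imp_continuous by (auto simp: psmooth_def)
  then have "norm (fc (\<lambda>t. S t * cis (x * sin t)) p) \<le> 2 * pi * K" for x p
    using K by (intro fc_norm_le continuous_intros) (auto simp: norm_mult)
  then show ?case using K(1) by (intro exI[of _ "2 * pi * K"]) auto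
next
  case (Suc a)
  obtain S' where S': "\<And>x. (S has_vector_derivative S' x) (at x)" "psmooth S'"
    using psmooth_deriv[OF Suc.prems] by blast
  define T where "T t = \<i> * (S t * of_real (cos t))" for t
  have T: "psmooth T" unfolding T_def by (intro psmooth_mult psmooth_const Suc.prems psmooth_cos)
  obtain C1 where C1: "C1 \<ge> 0" "\<And>x p. x \<ge> 0 \<Longrightarrow> \<bar>of_int p\<bar> ^ a * norm (fc (\<lambda>t. S' t * cis (x * sin t)) p) \<le> C1 * (1 + x) ^ a"
    using Suc.IH[OF S'(2)] by blast
  obtain C2 where C2: "C2 \<ge> 0" "\<And>x p. x \<ge> 0 \<Longrightarrow> \<bar>of_int p\<bar> ^ a * norm (fc (\<lambda>t. T t * cis (x * sin t)) p) \<le> C2 * (1 + x) ^ a"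
    using Suc.IH[OF T] by blast
  have cont: "continuous_on UNIV S" "continuous_on UNIV S'" "continuous_on UNIV T"
    using Suc.prems S'(2) T smooth_imp_continuous by (auto simp: psmooth_def)
  have "\<bar>of_int p\<bar> ^ Suc a * norm (fc (\<lambda>t. S t * cis (x * sin t)) p) \<le> (C1 + C2) * (1 + x) ^ Suc a"
    if x: "x \<ge> 0" for x p
  proof -
    let ?d = "\<lambda>t. S' t * cis (x * sin t) + of_real x * (T t * cis (x * sin t))"
    have c1: "continuous_on UNIV (\<lambda>t. S' t * cis (x * sin t))"
      "continuous_on UNIV (\<lambda>t. of_real x * (T t * cis (x * sin t)))"
      by (intro continuous_intros cont)+
    have "((\<lambda>t. S t * cis (x * sin t)) has_vector_derivative ?d t) (at t)" for t
      unfolding T_def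
      by (rule derivative_eq_intros S' has_vector_derivative_cis refl)+ (auto simp: algebra_simps)
    moreover have "periodic (\<lambda>t. S t * cis (x * sin t))"
      using Suc.prems by (simp add: psmooth_def periodic_def)
    ultimately have "fc ?d p = \<i> * of_int p * fc (\<lambda>t. S t * cis (x * sin t)) p"
      by (intro fc_deriv continuous_intros cont) auto
    then have "\<bar>of_int p\<bar> * norm (fc (\<lambda>t. S t * cis (x * sin t)) p) = norm (fc ?d p)"
      by (simp add: norm_mult)
    also have "\<dots> = norm (fc (\<lambda>t. S' t * cis (x * sin t)) p + of_real x * fc (\<lambda>t. T t * cis (x * sin t)) p)"
      using fc_add[OF c1] by (simp add: fc_cmult)
    also have "\<dots> \<le> norm (fc (\<lambda>t. S' t * cis (x * sin t)) p) + x * norm (fc (\<lambda>t. T t * cis (x * sin t)) p)"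
      by (rule order_trans[OF norm_triangle_ineq]) (use x in \<open>simp add: norm_mult\<close>)
    finally have "\<bar>of_int p\<bar> ^ a * (\<bar>of_int p\<bar> * norm (fc (\<lambda>t. S t * cis (x * sin t)) p))
      \<le> \<bar>of_int p\<bar> ^ a * (norm (fc (\<lambda>t. S' t * cis (x * sin t)) p) + x * norm (fc (\<lambda>t. T t * cis (x * sin t)) p))"
      by (intro mult_left_mono) auto
    also have "\<dots> = \<bar>of_int p\<bar> ^ a * norm (fc (\<lambda>t. S' t * cis (x * sin t)) p) + x * (\<bar>of_int p\<bar> ^ a * norm (fc (\<lambda>t. T t * cis (x * sin t)) p))"
      by (simp add: algebra_simps)
    also have "\<dots> \<le> C1 * (1 + x) ^ a + x * (C2 * (1 + x) ^ a)"
      using x C1 C2 by (intro add_mono mult_left_mono) auto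
    also have "\<dots> \<le> (1 + x) * (C1 * (1 + x) ^ a) + (1 + x) * (C2 * (1 + x) ^ a)"
      using x C1 C2 mult_right_mono[of 1 "1 + x" "C1 * (1 + x) ^ a"] by (intro add_mono mult_right_mono) auto
    finally show ?thesis by (simp add: algebra_simps)
  qed
  then show ?case using C1(1) C2(1) by (intro exI[of _ "C1 + C2"]) auto
qed

text \<open>This is the phase \<open>B\<close> of the overview. Since \<open>M\<close> is a natural
  number, the linear part winds an integer number of times per period, so composition with a
  periodic function is again periodic.\<close>

definition phase :: "nat \<Rightarrow> real \<Rightarrow> real \<Rightarrow> real" where
  "phase M \<theta> t = (real M)\<^sup>2 * t + real M * sin t + \<theta>"

lemma smooth_phase: "smooth (phase M \<theta>)"
  unfolding phase_def [abs_def] by (intro smooth_intros smooth_sin)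

lemma periodic_compose_phase:
  assumes "periodic g"
  shows "periodic (\<lambda>t. g (phase M \<theta> t))"
  unfolding periodic_def
proof
  fix t
  have "phase M \<theta> (t + 2 * pi) = phase M \<theta> t + 2 * pi * of_int (int M ^ 2)"
    unfolding phase_def sin_periodic by (simp add: algebra_simps)
  then show "g (phase M \<theta> (t + 2 * pi)) = g (phase M \<theta> t)"
    using periodic_int[OF assms] by metis
qed

lemma psmooth_compose_phase: "psmooth g \<Longrightarrow> psmooth (\<lambda>t. g (phase M \<theta> t))"
  by (simp add: psmooth_def periodic_compose_phase smooth_compose smooth_phase)

lemma has_vector_derivative_compose_phase:
  fixes g :: "real \<Rightarrow> complex"
  assumes "(g has_vector_derivative g') (at (phase M \<theta> t))"
  shows "((\<lambda>t. g (phase M \<theta> t)) has_vector_derivative of_real ((real M)\<^sup>2 + real M * cos t) * g') (at t)"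
proof -
  have "(phase M \<theta> has_real_derivative ((real M)\<^sup>2 + real M * cos t)) (at t)"
    unfolding phase_def [abs_def] by (auto intro!: derivative_eq_intros)
  then have "(phase M \<theta> has_vector_derivative ((real M)\<^sup>2 + real M * cos t)) (at t)"
    by (simp add: has_real_derivative_iff_has_vector_derivative)
  from vector_diff_chain_at[OF this assms] show ?thesis
    by (simp add: o_def scaleR_conv_of_real)
qed

lemma has_vector_derivative_power:
  fixes f :: "real \<Rightarrow> complex"
  assumes "(f has_vector_derivative f') (at x)"
  shows "((\<lambda>x. f x ^ n) has_vector_derivative of_nat n * (f x ^ (n - 1) * f')) (at x)"
proof -
  have "((\<lambda>x. f x ^ n) has_derivative (\<lambda>y. of_nat n * (y *\<^sub>R f') * f x ^ (n - 1))) (at x)"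
    using assms by (intro has_derivative_power) (simp add: has_vector_derivative_def)
  then show ?thesis
    unfolding has_vector_derivative_def
    by (rule has_derivative_eq_rhs) (auto simp: fun_eq_iff scaleR_conv_of_real)
qed

text \<open>Where \<open>b\<close> lives, the power of \<open>w\<close> is at most
  \<open>q ^ L\<close>. Each integration by parts costs at most a multiple of
  \<open>(1 + L) M^2\<close>: a factor of order \<open>M^2\<close> from the phase and a factor
  \<open>L\<close> from differentiating the power. Amplitude and bump vary in the induction because
  their derivatives replace them.\<close>

lemma fc_compose_power_decay:
  assumes w: "psmooth w" and q: "q > 0"
    and "psmooth S" "psmooth b" "\<And>x. q < norm (w x) \<Longrightarrow> b x = 0"
  shows "\<exists>C\<ge>0. \<forall>L M \<theta> n. M \<ge> 1 \<longrightarrow>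
    \<bar>of_int n\<bar> ^ a * norm (fc (\<lambda>t. S t * (w (phase M \<theta> t) ^ L * b (phase M \<theta> t))) n)
      \<le> C * ((1 + real L) * (real M)\<^sup>2) ^ a * q ^ L"
  using assms(3-5)
proof (induction a arbitrary: S b)
  case 0
  obtain K where K: "K > 0" "\<And>t. norm (S t) \<le> K" by (rule psmooth_bounded[OF 0(1)]) blast
  obtain K' where K': "K' > 0" "\<And>t. norm (b t) \<le> K'" by (rule psmooth_bounded[OF 0(2)]) blast
  have "norm (fc (\<lambda>t. S t * (w (phase M \<theta> t) ^ L * b (phase M \<theta> t))) n) \<le> 2 * pi * (K * (q ^ L * K'))" for L M \<theta> n
  proof (rule fc_norm_le)
    have "psmooth (\<lambda>t. S t * (w (phase M \<theta> t) ^ L * b (phase M \<theta> t)))"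
      by (intro psmooth_mult psmooth_power psmooth_compose_phase w 0)
    then show "continuous_on UNIV (\<lambda>t. S t * (w (phase M \<theta> t) ^ L * b (phase M \<theta> t)))"
      unfolding psmooth_def using smooth_imp_continuous by blast
  next
    fix t
    have "norm (w x ^ L * b x) \<le> q ^ L * K'" for x
    proof (cases "q < norm (w x)")
      case True
      then show ?thesis using 0(3) q K' by simp
    next
      case False
      then show ?thesis using K' q unfolding norm_mult norm_power
        by (intro mult_mono power_mono) auto
    qed
    then show "norm (S t * (w (phase M \<theta> t) ^ L * b (phase M \<theta> t))) \<le> K * (q ^ L * K')"
      unfolding norm_mult[of "S t"] using K by (intro mult_mono) auto
  qed
  then show ?case using K K'
    by (intro exI[of _ "2 * pi * (K * K')"]) (auto simp: mult_ac)
next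
  case (Suc a)
  obtain S' where S': "\<And>x. (S has_vector_derivative S' x) (at x)" "psmooth S'"
    using psmooth_deriv[OF Suc.prems(1)] by blast
  obtain b' where b': "\<And>x. (b has_vector_derivative b' x) (at x)" "psmooth b'"
    using psmooth_deriv[OF Suc.prems(2)] by blast
  obtain w' where w': "\<And>x. (w has_vector_derivative w' x) (at x)" "psmooth w'"
    using psmooth_deriv[OF w] by blast
  have cw: "continuous_on UNIV w" using w smooth_imp_continuous by (auto simp: psmooth_def)
  \<comment> \<open>The support condition passes to \<open>b'\<close> because the set where
    \<open>w\<close> exceeds \<open>q\<close> in modulus is open.\<close>
  have b'0: "b' x = 0" if "q < norm (w x)" for x
  proof -
    have "open {x. q < norm (w x)}" by (intro open_Collect_less continuous_intros cw)
    moreover have "((\<lambda>x. 0) has_vector_derivative (0::complex)) (at x)" by simp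
    ultimately have "(b has_vector_derivative 0) (at x)"
      using that Suc.prems(3)
      by (intro has_vector_derivative_transform_within_open[of "\<lambda>_. 0" 0 x "{x. q < norm (w x)}" b]) auto
    then show ?thesis using b'(1) vector_derivative_unique_at by blast
  qed
  define B where "B x = w' x * b x" for x
  have B: "psmooth B" "\<And>x. q < norm (w x) \<Longrightarrow> B x = 0"
    using w' Suc.prems(2,3) by (auto simp: B_def [abs_def] intro: psmooth_mult)
  define T where "T t = S t * of_real (cos t)" for t
  have T: "psmooth T" unfolding T_def by (intro psmooth_mult Suc.prems psmooth_cos)
  define Y where "Y s c L M \<theta> = (\<lambda>t. s t * (w (phase M \<theta> t) ^ L * c (phase M \<theta> t)))" for s c :: "real \<Rightarrow> complex" and L M \<theta>
  have contY: "continuous_on UNIV (Y s c L M \<theta>)" if "psmooth s" "psmooth c" for s c L M \<theta>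
  proof -
    have "psmooth (Y s c L M \<theta>)" unfolding Y_def
      by (intro psmooth_mult psmooth_power psmooth_compose_phase w that)
    then show ?thesis unfolding psmooth_def using smooth_imp_continuous by blast
  qed
  let ?P = "\<lambda>L M. ((1 + real L) * (real M)\<^sup>2) ^ a"
  have IH: "\<exists>C\<ge>0. \<forall>L M \<theta> n. M \<ge> 1 \<longrightarrow> \<bar>of_int n\<bar> ^ a * norm (fc (Y s c L M \<theta>) n) \<le> C * ?P L M * q ^ L"
    if "psmooth s" "psmooth c" "\<And>x. q < norm (w x) \<Longrightarrow> c x = 0" for s c
    using Suc.IH[OF that] unfolding Y_def .
  obtain C1 where C1: "C1 \<ge> 0" "\<And>L M \<theta> n. M \<ge> 1 \<Longrightarrow> \<bar>of_int n\<bar> ^ a * norm (fc (Y S' b L M \<theta>) n) \<le> C1 * ?P L M * q ^ L"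
    using IH[OF S'(2) Suc.prems(2,3)] by blast
  obtain C2 where C2: "C2 \<ge> 0" "\<And>L M \<theta> n. M \<ge> 1 \<Longrightarrow> \<bar>of_int n\<bar> ^ a * norm (fc (Y S b' L M \<theta>) n) \<le> C2 * ?P L M * q ^ L"
    using IH[OF Suc.prems(1) b'(2) b'0] by blast
  obtain C3 where C3: "C3 \<ge> 0" "\<And>L M \<theta> n. M \<ge> 1 \<Longrightarrow> \<bar>of_int n\<bar> ^ a * norm (fc (Y S B L M \<theta>) n) \<le> C3 * ?P L M * q ^ L"
    using IH[OF Suc.prems(1) B] by blast
  obtain C4 where C4: "C4 \<ge> 0" "\<And>L M \<theta> n. M \<ge> 1 \<Longrightarrow> \<bar>of_int n\<bar> ^ a * norm (fc (Y T b' L M \<theta>) n) \<le> C4 * ?P L M * q ^ L"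
    using IH[OF T b'(2) b'0] by blast
  obtain C5 where C5: "C5 \<ge> 0" "\<And>L M \<theta> n. M \<ge> 1 \<Longrightarrow> \<bar>of_int n\<bar> ^ a * norm (fc (Y T B L M \<theta>) n) \<le> C5 * ?P L M * q ^ L"
    using IH[OF T B] by blast
  \<comment> \<open>Differentiating the power lowers its exponent by one, which costs a factor
    \<open>1 / q\<close>. For \<open>L = 0\<close> the truncated exponent \<open>L - 1\<close> is
    harmless, the prefactor \<open>L\<close> being 0.\<close>
  have lower: "real L * (\<bar>of_int n\<bar> ^ a * norm (fc (Y s B (L - 1) M \<theta>) n)) \<le> real L * (C / q * (?P L M * q ^ L))"
    if "C \<ge> 0" "M \<ge> 1" "\<And>L M \<theta> n. M \<ge> 1 \<Longrightarrow> \<bar>of_int n\<bar> ^ a * norm (fc (Y s B L M \<theta>) n) \<le> C * ?P L M * q ^ L"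
    for s C L M \<theta> n
  proof (cases L)
    case (Suc l)
    have "\<bar>of_int n\<bar> ^ a * norm (fc (Y s B l M \<theta>) n) \<le> C * ?P l M * q ^ l" using that by blast
    also have "\<dots> \<le> C * ?P L M * q ^ l"
      using that(1) q Suc by (intro mult_right_mono mult_left_mono power_mono) auto
    also have "\<dots> = C / q * (?P L M * q ^ L)" using q Suc by (simp add: field_simps)
    finally show ?thesis using Suc by (intro mult_left_mono) auto
  qed simp
  let ?C = "C1 + C2 + C3 / q + C4 + C5 / q"
  have "\<bar>of_int n\<bar> ^ Suc a * norm (fc (Y S b L M \<theta>) n) \<le> ?C * ((1 + real L) * (real M)\<^sup>2) ^ Suc a * q ^ L"
    if M: "M \<ge> 1" for L M \<theta> n
  proof -
    let ?F = "\<lambda>s c L. fc (Y s c L M \<theta>) n" and ?p = "\<bar>real_of_int n\<bar> ^ a"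
    \<comment> \<open>\<open>d1\<close> holds the derivative of the amplitude and the contribution
      of the linear part \<open>M^2\<close> of the phase derivative, \<open>d2\<close> the
      contribution of its part \<open>M cos t\<close>.\<close>
    define d1 where "d1 t = Y S' b L M \<theta> t + of_real ((real M)\<^sup>2) * (Y S b' L M \<theta> t + of_nat L * Y S B (L - 1) M \<theta> t)" for t
    define d2 where "d2 t = of_real (real M) * (Y T b' L M \<theta> t + of_nat L * Y T B (L - 1) M \<theta> t)" for t
    note cY = contY[OF S'(2) Suc.prems(2)] contY[OF Suc.prems(1) b'(2)] contY[OF Suc.prems(1) B(1)] contY[OF T b'(2)] contY[OF T B(1)]
    have c1: "continuous_on UNIV d1" "continuous_on UNIV d2"
      unfolding d1_def d2_def by (intro continuous_intros cY)+
    have "((\<lambda>x. w x ^ L * b x) has_vector_derivative (w x ^ L * b' x + of_nat L * (w x ^ (L - 1) * w' x) * b x)) (at x)" for x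
      by (intro has_vector_derivative_mult has_vector_derivative_power w' b')
    from has_vector_derivative_mult[OF S'(1) has_vector_derivative_compose_phase[OF this]]
    have "(Y S b L M \<theta> has_vector_derivative (d1 t + d2 t)) (at t)" for t
      unfolding Y_def d1_def d2_def T_def B_def
      by (rule has_vector_derivative_eq_rhs) (simp add: algebra_simps)
    moreover have "periodic (Y S b L M \<theta>)"
      using psmooth_mult[OF Suc.prems(1) psmooth_compose_phase[OF psmooth_mult[OF psmooth_power[OF w] Suc.prems(2)]]]
      unfolding psmooth_def Y_def by blast
    ultimately have "fc (\<lambda>t. d1 t + d2 t) n = \<i> * of_int n * ?F S b L"
      using c1 by (intro fc_deriv continuous_on_add) auto
    moreover have "fc (\<lambda>t. d1 t + d2 t) n = ?F S' b L + of_real ((real M)\<^sup>2) * (?F S b' L + of_nat L * ?F S B (L - 1))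
        + of_real (real M) * (?F T b' L + of_nat L * ?F T B (L - 1))"
    proof -
      have k: "fc (\<lambda>t. Y s b' L M \<theta> t + of_nat L * Y s B (L - 1) M \<theta> t) n = ?F s b' L + of_nat L * ?F s B (L - 1)"
        if "psmooth s" for s
        using fc_add[OF contY[OF that b'(2)] continuous_on_mult_left[OF contY[OF that B(1)]]]
        by (simp add: fc_cmult)
      have "fc d1 n = ?F S' b L + fc (\<lambda>t. of_real ((real M)\<^sup>2) * (Y S b' L M \<theta> t + of_nat L * Y S B (L - 1) M \<theta> t)) n"
        unfolding d1_def by (rule fc_add) (intro continuous_intros cY)+
      also have "\<dots> = ?F S' b L + of_real ((real M)\<^sup>2) * (?F S b' L + of_nat L * ?F S B (L - 1))"
        unfolding fc_cmult k[OF Suc.prems(1)] ..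
      finally have "fc d1 n = ?F S' b L + of_real ((real M)\<^sup>2) * (?F S b' L + of_nat L * ?F S B (L - 1))" .
      moreover have "fc d2 n = of_real (real M) * (?F T b' L + of_nat L * ?F T B (L - 1))"
        unfolding d2_def fc_cmult k[OF T] ..
      ultimately show ?thesis using fc_add[OF c1] by simp
    qed
    ultimately have "\<bar>of_int n\<bar> * norm (?F S b L) = norm (?F S' b L + of_real ((real M)\<^sup>2) * (?F S b' L + of_nat L * ?F S B (L - 1))
        + of_real (real M) * (?F T b' L + of_nat L * ?F T B (L - 1)))"
      by (metis (no_types, lifting) norm_mult norm_ii mult_1 norm_of_int)
    also have "\<dots> \<le> norm (?F S' b L) + (real M)\<^sup>2 * (norm (?F S b' L) + real L * norm (?F S B (L - 1)))
        + real M * (norm (?F T b' L) + real L * norm (?F T B (L - 1)))"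
      by (intro order_trans[OF norm_triangle_ineq] add_mono order_refl)
        (simp_all add: norm_mult norm_power mult_left_mono order_trans[OF norm_triangle_ineq])
    finally have "?p * (\<bar>of_int n\<bar> * norm (?F S b L)) \<le> ?p * (norm (?F S' b L) + (real M)\<^sup>2 * (norm (?F S b' L) + real L * norm (?F S B (L - 1)))
        + real M * (norm (?F T b' L) + real L * norm (?F T B (L - 1))))"
      by (intro mult_left_mono) auto
    also have "\<dots> = ?p * norm (?F S' b L) + (real M)\<^sup>2 * (?p * norm (?F S b' L) + real L * (?p * norm (?F S B (L - 1))))
        + real M * (?p * norm (?F T b' L) + real L * (?p * norm (?F T B (L - 1))))"
      by (simp add: algebra_simps)
    also have "\<dots> \<le> C1 * ?P L M * q ^ L + (real M)\<^sup>2 * (C2 * ?P L M * q ^ L + real L * (C3 / q * (?P L M * q ^ L)))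
        + real M * (C4 * ?P L M * q ^ L + real L * (C5 / q * (?P L M * q ^ L)))"
      using M C1 C2 C3 C4 C5 by (intro add_mono mult_left_mono lower) auto
    also have "\<dots> = (C1 + (real M)\<^sup>2 * (C2 + real L * (C3 / q)) + real M * (C4 + real L * (C5 / q))) * (?P L M * q ^ L)"
      by (simp add: algebra_simps)
    also have "\<dots> \<le> (?C * ((1 + real L) * (real M)\<^sup>2)) * (?P L M * q ^ L)"
    proof (intro mult_right_mono)
      define X where "X = (1 + real L) * (real M)\<^sup>2"
      have M1: "1 \<le> real M" using M by simp
      then have M2: "real M \<le> (real M)\<^sup>2" by (simp add: power2_eq_square)
      have X1: "(real M)\<^sup>2 \<le> X" "(real M)\<^sup>2 * real L \<le> X" by (auto simp: X_def algebra_simps)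
      have X2: "1 \<le> X" "real M \<le> X" using M1 M2 X1(1) by linarith+
      have X3: "real M * real L \<le> X" using mult_right_mono[OF M2, of "real L"] X1(2) by simp
      have "C1 + (real M)\<^sup>2 * (C2 + real L * (C3 / q)) + real M * (C4 + real L * (C5 / q))
        = C1 * 1 + C2 * (real M)\<^sup>2 + C3 / q * ((real M)\<^sup>2 * real L) + C4 * real M + C5 / q * (real M * real L)"
        by (simp add: algebra_simps)
      also have "\<dots> \<le> C1 * X + C2 * X + C3 / q * X + C4 * X + C5 / q * X"
        using C1(1) C2(1) C3(1) C4(1) C5(1) q X1 X2 X3 by (intro add_mono mult_left_mono) auto
      finally show "C1 + (real M)\<^sup>2 * (C2 + real L * (C3 / q)) + real M * (C4 + real L * (C5 / q)) \<le> ?C * ((1 + real L) * (real M)\<^sup>2)"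
        by (simp add: X_def algebra_simps)
    qed (use q in auto)
    finally show ?thesis by (simp add: mult_ac)
  qed
  then show ?case using C1(1) C2(1) C3(1) C4(1) C5(1) q unfolding Y_def
    by (intro exI[of _ ?C]) auto
qed

section \<open>A van der Corput estimate for the chirp\<close>

lemma continuous_UNIV_integrable:
  fixes f :: "real \<Rightarrow> 'a::banach"
  shows "continuous_on UNIV f \<Longrightarrow> f integrable_on {a..b}"
  by (intro integrable_continuous_interval) (rule continuous_on_subset[OF _ subset_UNIV])

lemma integral_deriv_le:
  fixes h :: "real \<Rightarrow> real"
  assumes "a \<le> b" "\<And>t. (h has_real_derivative h' t) (at t)" "\<And>t. \<bar>h t\<bar> \<le> K / 2"
    "\<And>t. t \<in> {a..b} \<Longrightarrow> f t = h' t"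
  shows "f integrable_on {a..b} \<and> integral {a..b} f \<le> K"
proof -
  have "(h' has_integral (h b - h a)) {a..b}"
    using assms(1,2) by (intro fundamental_theorem_of_calculus)
      (auto intro: has_field_derivative_at_within simp: has_real_derivative_iff_has_vector_derivative[symmetric])
  then have "(f has_integral (h b - h a)) {a..b}"
    using assms(4) by (metis has_integral_eq)
  moreover have "h b - h a \<le> K" using assms(3)[of a] assms(3)[of b] by linarith
  ultimately show ?thesis by (auto simp: integral_unique)
qed

lemma integral_split_le:
  fixes f :: "real \<Rightarrow> real"
  assumes "a \<le> c" "c \<le> b" "f integrable_on {a..c} \<and> integral {a..c} f \<le> K"
    "f integrable_on {c..b} \<and> integral {c..b} f \<le> K'"
  shows "f integrable_on {a..b} \<and> integral {a..b} f \<le> K + K'"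
proof -
  have "f integrable_on {a..b}"
    using Henstock_Kurzweil_Integration.integrable_combine[OF assms(1,2)] assms(3,4) by blast
  with Henstock_Kurzweil_Integration.integral_combine[OF assms(1,2) this] assms(3,4)
  show ?thesis by linarith
qed

lemma arctan_resolvent_deriv:
  fixes k :: real
  assumes "(u has_real_derivative u') (at t)" "k > 0"
  shows "((\<lambda>t. arctan (u t / k) / k) has_real_derivative u' / ((u t)\<^sup>2 + k\<^sup>2)) (at t)"
proof -
  have "((\<lambda>t. arctan (u t / k) / k) has_real_derivative inverse (1 + (u t / k)\<^sup>2) * (u' / k) / k) (at t)"
    using assms by (intro DERIV_cdivide DERIV_chain2[OF DERIV_arctan])
  moreover have "1 + (u t / k)\<^sup>2 = ((u t)\<^sup>2 + k\<^sup>2) / k\<^sup>2"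
    using assms(2) by (simp add: power_divide add_divide_distrib)
  ultimately show ?thesis using assms(2) by (simp add: power2_eq_square)
qed

text \<open>On each half of the period \<open>sin\<close> has constant sign, and the integrand is up
  to sign the derivative of an arctangent divided by \<open>\<kappa>\<close>, which varies by at
  most \<open>pi / \<kappa>\<close>. Hence the bound is uniform in \<open>x\<close> and
  \<open>p\<close>.\<close>

lemma integral_sin_resolvent:
  assumes k: "\<kappa> > 0"
  shows "integral {0..2 * pi} (\<lambda>t. x * \<bar>sin t\<bar> / ((x * cos t - p)\<^sup>2 + \<kappa>\<^sup>2)) \<le> 2 * pi / \<kappa>" (is "integral _ ?f \<le> _")
proof -
  have d: "((\<lambda>t. - (arctan ((x * cos t - p) / \<kappa>) / \<kappa>)) has_real_derivative x * sin t / ((x * cos t - p)\<^sup>2 + \<kappa>\<^sup>2)) (at t)" for t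
  proof -
    have "((\<lambda>t. x * cos t - p) has_real_derivative - (x * sin t)) (at t)"
      by (auto intro!: derivative_eq_intros)
    from DERIV_minus[OF arctan_resolvent_deriv[OF this k]] show ?thesis by simp
  qed
  have bd: "\<bar>arctan u / \<kappa>\<bar> \<le> pi / \<kappa> / 2" "\<bar>- (arctan u / \<kappa>)\<bar> \<le> pi / \<kappa> / 2" for u
    using arctan_bounded[of u] k by (simp_all add: abs_if field_simps)
  have 1: "?f integrable_on {0..pi} \<and> integral {0..pi} ?f \<le> pi / \<kappa>"
    by (rule integral_deriv_le[OF _ d bd(2)]) (auto simp: sin_ge_zero)
  have d': "((\<lambda>t. arctan ((x * cos t - p) / \<kappa>) / \<kappa>) has_real_derivative - (x * sin t / ((x * cos t - p)\<^sup>2 + \<kappa>\<^sup>2))) (at t)" for t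
    using DERIV_minus[OF d[of t]] by simp
  have s: "sin t \<le> 0" if "pi \<le> t" "t \<le> 2 * pi" for t
    using that sin_ge_zero[of "t - pi"] by (simp add: sin_diff)
  have 2: "?f integrable_on {pi..2 * pi} \<and> integral {pi..2 * pi} ?f \<le> pi / \<kappa>"
    by (rule integral_deriv_le[OF _ d' bd(1)]) (auto simp: s abs_of_nonpos)
  show ?thesis using integral_split_le[OF _ _ 1 2] by simp
qed

text \<open>Up to sign the integrand is the derivative of \<open>arctan (sin t / \<sigma>)\<close>.
  The sign of \<open>cos\<close> cuts the period into three intervals, each contributing at most
  \<open>pi\<close>.\<close>

lemma integral_cos_resolvent:
  assumes k: "\<sigma> > 0"
  shows "integral {0..2 * pi} (\<lambda>t. \<sigma> * \<bar>cos t\<bar> / ((sin t)\<^sup>2 + \<sigma>\<^sup>2)) \<le> 3 * pi" (is "integral _ ?f \<le> _")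
proof -
  have d: "((\<lambda>t. arctan (sin t / \<sigma>)) has_real_derivative \<sigma> * cos t / ((sin t)\<^sup>2 + \<sigma>\<^sup>2)) (at t)" for t
    using DERIV_cmult[OF arctan_resolvent_deriv[OF DERIV_sin k], of \<sigma> t] k by simp
  have d': "((\<lambda>t. - arctan (sin t / \<sigma>)) has_real_derivative - (\<sigma> * cos t / ((sin t)\<^sup>2 + \<sigma>\<^sup>2))) (at t)" for t
    using DERIV_minus[OF d[of t]] by simp
  have bd: "\<bar>arctan u\<bar> \<le> pi / 2" "\<bar>- arctan u\<bar> \<le> pi / 2" for u
    using arctan_bounded[of u] by (auto simp: abs_if)
  have c1: "cos t \<ge> 0" if "t \<in> {0..pi/2}" for t using that by (intro cos_ge_zero) auto
  have c2: "cos t \<le> 0" if "t \<in> {pi/2..3*pi/2}" for t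
    using that cos_ge_zero[of "t - pi"] by (simp add: cos_diff)
  have c3: "cos t \<ge> 0" if "t \<in> {3*pi/2..2*pi}" for t
    using that cos_ge_zero[of "t - 2*pi"] by (simp add: cos_diff)
  have 1: "?f integrable_on {0..pi/2} \<and> integral {0..pi/2} ?f \<le> pi"
    by (rule integral_deriv_le[OF _ d bd(1)]) (use c1 in auto)
  have 2: "?f integrable_on {pi/2..3*pi/2} \<and> integral {pi/2..3*pi/2} ?f \<le> pi"
    by (rule integral_deriv_le[OF _ d' bd(2)]) (use c2 in \<open>auto simp: abs_of_nonpos\<close>)
  have 3: "?f integrable_on {3*pi/2..2*pi} \<and> integral {3*pi/2..2*pi} ?f \<le> pi"
    by (rule integral_deriv_le[OF _ d bd(1)]) (use c3 in auto)
  have 4: "?f integrable_on {0..3*pi/2} \<and> integral {0..3*pi/2} ?f \<le> pi + pi"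
    by (rule integral_split_le[OF _ _ 1 2]) auto
  show ?thesis using integral_split_le[OF _ _ 4 3] by simp
qed

text \<open>The gain is uniform in the frequency \<open>p\<close>, although the derivative of the
  total phase may vanish and even have a degenerate zero. The parameter \<open>y\<close> stands for
  a fourth root of \<open>x\<close>, and one derivative of \<open>f\<close> suffices.\<close>

lemma fc_phase_vdCorput:
  assumes f: "periodic f" "\<And>t. (f has_vector_derivative f' t) (at t)" "continuous_on UNIV f'"
    and K: "\<And>t. norm (f t) \<le> K" "\<And>t. norm (f' t) \<le> K"
    and y: "y \<ge> 1" and x: "x \<ge> y ^ 4"
  shows "norm (fc (\<lambda>t. f t * cis (x * sin t)) p) \<le> 60 * K / y"
proof -
  \<comment> \<open>Split \<open>1 = d\<^sup>2 / (d\<^sup>2 + \<kappa>\<^sup>2) + \<kappa>\<^sup>2 / (d\<^sup>2 + \<kappa>\<^sup>2)\<close>, where \<open>d\<close> is the derivative of the phase: the first part is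
    integrated by parts, the second is small off the points where \<open>d\<close> or \<open>sin\<close> is small.\<close>
  define \<kappa> where "\<kappa> = y\<^sup>2"
  define \<sigma> where "\<sigma> = 1 / y"
  have y0: "y > 0" using y by simp
  have \<kappa>: "\<kappa> > 0" and \<sigma>: "\<sigma> > 0" using y0 by (auto simp: \<kappa>_def \<sigma>_def)
  have x0: "x > 0" using x y0 by (meson less_le_trans zero_less_power)
  have K0: "K \<ge> 0" using K(1)[of 0] norm_ge_zero order_trans by blast
  define d where "d t = x * cos t - of_int p" for t
  define Q where "Q t = (d t)\<^sup>2 + \<kappa>\<^sup>2" for t
  have Q: "Q t > 0" for t using \<kappa> by (simp add: Q_def add_nonneg_pos)
  then have Qne: "Q t \<noteq> 0" for t by (metis less_irrefl)
  \<comment> \<open>\<open>r\<close> replaces the reciprocal \<open>1 / d\<close> of ordinary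
    integration by parts; it stays regular at the zeros of \<open>d\<close>, and \<open>d r\<close>
    falls short of 1 by exactly \<open>\<kappa>^2 / Q\<close>.\<close>
  define r where "r t = d t / Q t" for t
  define r' where "r' t = - (x * sin t) * (\<kappa>\<^sup>2 - (d t)\<^sup>2) / (Q t)\<^sup>2" for t
  have dr: "(r has_real_derivative r' t) (at t)" for t
  proof -
    have d1: "(d has_real_derivative - (x * sin t)) (at t)"
      unfolding d_def [abs_def] by (auto intro!: derivative_eq_intros)
    then have q1: "(Q has_real_derivative 2 * d t * - (x * sin t)) (at t)"
      unfolding Q_def [abs_def] by (auto intro!: derivative_eq_intros)
    have "(r has_real_derivative (- (x * sin t) * Q t - d t * (2 * d t * - (x * sin t))) / (Q t * Q t)) (at t)"
      unfolding r_def [abs_def] using Q[of t] by (intro DERIV_divide d1 q1) auto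
    moreover have "- (x * sin t) * Q t - d t * (2 * d t * - (x * sin t)) = - (x * sin t) * (\<kappa>\<^sup>2 - (d t)\<^sup>2)"
      by (simp add: Q_def algebra_simps power2_eq_square)
    ultimately show ?thesis by (simp add: r'_def power2_eq_square)
  qed
  define \<phi> where "\<phi> t = x * sin t - of_int p * t" for t
  have d\<phi>: "(\<phi> has_real_derivative d t) (at t)" for t
    unfolding \<phi>_def [abs_def] d_def by (auto intro!: derivative_eq_intros)
  define h where "h t = f t * of_real (r t) * cis (\<phi> t)" for t
  define g' where "g' t = f' t * of_real (r t) + f t * of_real (r' t)" for t
  define e where "e t = f t * of_real (\<kappa>\<^sup>2 / Q t)" for t
  have cd: "continuous_on UNIV d" "continuous_on UNIV Q" "continuous_on UNIV \<phi>"
    unfolding d_def Q_def \<phi>_def by (intro continuous_intros)+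
  have cr: "continuous_on UNIV r" "continuous_on UNIV r'" unfolding r_def r'_def
    by (intro continuous_intros cd; simp add: Qne)+
  have cf: "continuous_on UNIV f" using continuous_on_UNIV_if_deriv f(2) by blast
  have cg: "continuous_on UNIV g'" "continuous_on UNIV e"
    unfolding g'_def e_def by (intro continuous_intros cr cf f cd; simp add: Qne)+
  have dh: "(h has_vector_derivative (g' t * cis (\<phi> t) + \<i> * (f t * cis (\<phi> t) - e t * cis (\<phi> t)))) (at t)" for t
  proof -
    have "d t * r t = 1 - \<kappa>\<^sup>2 / Q t"
      using Q[of t] by (simp add: r_def field_simps) (simp add: Q_def power2_eq_square)
    then have *: "of_real (d t) * of_real (r t) = (1 - of_real (\<kappa>\<^sup>2 / Q t) :: complex)"
      unfolding of_real_mult[symmetric] by simp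
    have "(h has_vector_derivative (f t * of_real (r t) * (\<i> * of_real (d t) * cis (\<phi> t)) + (f t * of_real (r' t) + f' t * of_real (r t)) * cis (\<phi> t))) (at t)"
      unfolding h_def [abs_def]
      by (intro has_vector_derivative_mult f has_vector_derivative_of_real dr has_vector_derivative_cis d\<phi>)
    moreover have "e t = f t - f t * (of_real (d t) * of_real (r t))"
      unfolding * e_def by (simp add: algebra_simps)
    then have "f t * of_real (r t) * (\<i> * of_real (d t) * cis (\<phi> t)) + (f t * of_real (r' t) + f' t * of_real (r t)) * cis (\<phi> t)
      = g' t * cis (\<phi> t) + \<i> * (f t * cis (\<phi> t) - e t * cis (\<phi> t))"
      unfolding g'_def by (simp only: left_diff_distrib) (simp add: algebra_simps)
    ultimately show ?thesis by simp
  qed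
  have "h (2 * pi) = h 0"
  proof -
    have "f (2 * pi) = f 0" using f(1) unfolding periodic_def by (metis add_0)
    moreover have "r (2 * pi) = r 0" by (simp add: r_def Q_def d_def)
    moreover have "\<phi> (2 * pi) = 2 * pi * of_int (- p)" by (simp add: \<phi>_def)
    then have "cis (\<phi> (2 * pi)) = cis (\<phi> 0)" using cis_int_2pi[of "- p"] by (metis \<phi>_def cis_zero diff_self mult_zero_right sin_zero)
    ultimately show ?thesis by (simp add: h_def)
  qed
  have "integral {0..2 * pi} (\<lambda>t. g' t * cis (\<phi> t) + \<i> * (f t * cis (\<phi> t) - e t * cis (\<phi> t))) = 0"
    by (rule integral_periodic_deriv[OF dh]) fact
  moreover have ci: "(\<lambda>t. g' t * cis (\<phi> t)) integrable_on {0..2*pi}" "(\<lambda>t. f t * cis (\<phi> t)) integrable_on {0..2*pi}" "(\<lambda>t. e t * cis (\<phi> t)) integrable_on {0..2*pi}"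
    by (intro continuous_UNIV_integrable continuous_intros cg cf cd)+
  moreover have "integral {0..2*pi} (\<lambda>t. g' t * cis (\<phi> t) + \<i> * (f t * cis (\<phi> t) - e t * cis (\<phi> t)))
     = integral {0..2*pi} (\<lambda>t. g' t * cis (\<phi> t)) + \<i> * (integral {0..2*pi} (\<lambda>t. f t * cis (\<phi> t)) - integral {0..2*pi} (\<lambda>t. e t * cis (\<phi> t)))"
    using ci by (simp add: Henstock_Kurzweil_Integration.integral_add Henstock_Kurzweil_Integration.integral_diff integrable_diff)
  ultimately have "integral {0..2*pi} (\<lambda>t. f t * cis (\<phi> t)) = integral {0..2*pi} (\<lambda>t. e t * cis (\<phi> t)) + \<i> * integral {0..2*pi} (\<lambda>t. g' t * cis (\<phi> t))"
    by (simp add: complex_eq_iff)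
  also have "\<dots> = integral {0..2*pi} (\<lambda>t. e t * cis (\<phi> t) + \<i> * (g' t * cis (\<phi> t)))"
    using ci by (simp add: Henstock_Kurzweil_Integration.integral_add)
  also have "integral {0..2*pi} (\<lambda>t. f t * cis (\<phi> t)) = fc (\<lambda>t. f t * cis (x * sin t)) p"
    unfolding fc_def \<phi>_def by (simp add: mult.assoc cis_mult)
  finally have eq: "fc (\<lambda>t. f t * cis (x * sin t)) p = integral {0..2*pi} (\<lambda>t. e t * cis (\<phi> t) + \<i> * (g' t * cis (\<phi> t)))" .
  define A where "A t = x * \<bar>sin t\<bar> / Q t" for t
  define B where "B t = \<sigma> * \<bar>cos t\<bar> / ((sin t)\<^sup>2 + \<sigma>\<^sup>2)" for t
  have pos: "(sin t)\<^sup>2 + \<sigma>\<^sup>2 > 0" for t using \<sigma> by (simp add: add_nonneg_pos)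
  have cAB: "continuous_on UNIV A" "continuous_on UNIV B"
    unfolding A_def B_def by (intro continuous_intros cd; use \<sigma> in \<open>simp add: Qne\<close>)+
  define G where "G t = K * (1 / (2 * \<kappa>) + 2 * \<sigma>\<^sup>2 + (1 + \<kappa>\<^sup>2 / (x * \<sigma>)) * A t + 2 * \<sigma> * B t)" for t
  have iAB: "A integrable_on {0..2*pi}" "B integrable_on {0..2*pi}"
    by (intro continuous_UNIV_integrable cAB)+
  have bound: "norm (e t * cis (\<phi> t) + \<i> * (g' t * cis (\<phi> t))) \<le> G t" for t
  proof -
    have A0: "A t \<ge> 0" using Q[of t] x0 by (simp add: A_def)
    have B0: "B t \<ge> 0" using pos[of t] \<sigma> by (simp add: B_def)
    have q1: "\<kappa>\<^sup>2 / Q t \<le> 1" using Q[of t] by (simp add: Q_def field_simps)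
    have e1: "norm (e t) \<le> K * (\<kappa>\<^sup>2 / Q t)"
      using K(1)[of t] Q[of t] \<kappa> unfolding e_def norm_mult norm_of_real
      by (simp add: mult_right_mono divide_right_mono)
    \<comment> \<open>Away from the zeros of \<open>sin\<close>, the factor
      \<open>|sin t| / \<sigma>\<close> is at least 1 and turns the error into a multiple of
      \<open>A\<close>. Near them the error is only bounded by 1, but \<open>\<sigma> B\<close> is
      then bounded below up to \<open>\<sigma>^2\<close>, and \<open>B\<close> has bounded
      integral.\<close>
    have e2: "\<kappa>\<^sup>2 / Q t \<le> \<kappa>\<^sup>2 / (x * \<sigma>) * A t + 2 * \<sigma> * B t + 2 * \<sigma>\<^sup>2"
    proof (cases "\<bar>sin t\<bar> \<ge> \<sigma>")
      case True
      have "\<kappa>\<^sup>2 / Q t * 1 \<le> \<kappa>\<^sup>2 / Q t * (\<bar>sin t\<bar> / \<sigma>)"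
        using True \<sigma> Q[of t] by (intro mult_left_mono) auto
      also have "\<dots> = \<kappa>\<^sup>2 / (x * \<sigma>) * A t" using x0 by (simp add: A_def field_simps)
      finally show ?thesis using B0 \<sigma> by (simp add: add_increasing2)
    next
      case False
      then have s2: "(sin t)\<^sup>2 \<le> \<sigma>\<^sup>2" using \<sigma> by (simp add: abs_le_square_iff[symmetric])
      have "1 \<le> \<bar>cos t\<bar> + (sin t)\<^sup>2"
      proof -
        have "(cos t)\<^sup>2 \<le> \<bar>cos t\<bar>" using abs_cos_le_one[of t]
          mult_left_le[of "\<bar>cos t\<bar>" "\<bar>cos t\<bar>"] by (simp add: power2_eq_square)
        then show ?thesis using sin_cos_squared_add[of t] by linarith
      qed
      then have "\<sigma>\<^sup>2 * 1 \<le> \<sigma>\<^sup>2 * (\<bar>cos t\<bar> + (sin t)\<^sup>2)" by (intro mult_left_mono) auto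
      also have "\<dots> \<le> \<sigma>\<^sup>2 * \<bar>cos t\<bar> + \<sigma>\<^sup>2 * ((sin t)\<^sup>2 + \<sigma>\<^sup>2)" by (simp add: algebra_simps)
      finally have "\<sigma>\<^sup>2 / ((sin t)\<^sup>2 + \<sigma>\<^sup>2) \<le> (\<sigma>\<^sup>2 * \<bar>cos t\<bar> + \<sigma>\<^sup>2 * ((sin t)\<^sup>2 + \<sigma>\<^sup>2)) / ((sin t)\<^sup>2 + \<sigma>\<^sup>2)"
        using pos[of t] by (intro divide_right_mono) auto
      also have "\<dots> = \<sigma> * B t + \<sigma>\<^sup>2" using pos[of t] by (simp add: B_def add_divide_distrib power2_eq_square)
      finally have *: "\<sigma>\<^sup>2 / ((sin t)\<^sup>2 + \<sigma>\<^sup>2) \<le> \<sigma> * B t + \<sigma>\<^sup>2" .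
      have "1 / 2 \<le> \<sigma>\<^sup>2 / ((sin t)\<^sup>2 + \<sigma>\<^sup>2)" using s2 pos[of t] by (simp add: field_simps)
      then have "1 \<le> 2 * \<sigma> * B t + 2 * \<sigma>\<^sup>2" using * by linarith
      moreover have "0 \<le> \<kappa>\<^sup>2 / (x * \<sigma>) * A t" using x0 \<sigma> A0 by simp
      ultimately show ?thesis using q1 by linarith
    qed
    have r1: "\<bar>r t\<bar> \<le> 1 / (2 * \<kappa>)"
    proof -
      have "0 \<le> (\<bar>d t\<bar> - \<kappa>)\<^sup>2" by simp
      then have "2 * \<kappa> * \<bar>d t\<bar> \<le> Q t" by (simp add: Q_def power2_diff algebra_simps)
      then show ?thesis using Q[of t] \<kappa> by (simp add: r_def field_simps)
    qed
    have r2: "\<bar>r' t\<bar> \<le> A t"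
    proof -
      have "\<bar>\<kappa>\<^sup>2 - (d t)\<^sup>2\<bar> \<le> Q t" by (simp add: Q_def abs_le_iff)
      then have "x * \<bar>sin t\<bar> * \<bar>\<kappa>\<^sup>2 - (d t)\<^sup>2\<bar> / (Q t)\<^sup>2 \<le> x * \<bar>sin t\<bar> * Q t / (Q t)\<^sup>2"
        using x0 by (intro divide_right_mono mult_left_mono) auto
      also have "\<dots> = A t" using Q[of t] by (simp add: A_def power2_eq_square)
      finally show ?thesis using x0 by (simp add: r'_def abs_mult)
    qed
    have "norm (g' t) \<le> K * (1 / (2 * \<kappa>)) + K * A t"
      unfolding g'_def
      by (intro order_trans[OF norm_triangle_ineq] add_mono; simp only: norm_mult norm_of_real; intro mult_mono K r1 r2 K0; simp)
    then have "norm (e t) + norm (g' t) \<le> K * (\<kappa>\<^sup>2 / (x * \<sigma>) * A t + 2 * \<sigma> * B t + 2 * \<sigma>\<^sup>2) + (K * (1 / (2 * \<kappa>)) + K * A t)"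
      using e1 mult_left_mono[OF e2 K0] by linarith
    also have "\<dots> = G t" by (simp add: G_def algebra_simps)
    finally show ?thesis using norm_triangle_ineq[of "e t * cis (\<phi> t)" "\<i> * (g' t * cis (\<phi> t))"]
      by (simp add: norm_mult)
  qed
  have Gint: "(G has_integral K * ((1 / (2 * \<kappa>) + 2 * \<sigma>\<^sup>2) * (2 * pi) + (1 + \<kappa>\<^sup>2 / (x * \<sigma>)) * integral {0..2*pi} A + 2 * \<sigma> * integral {0..2*pi} B)) {0..2*pi}"
    unfolding G_def
    using has_integral_const_real[of "1 / (2 * \<kappa>) + 2 * \<sigma>\<^sup>2" 0 "2 * pi"]
    by (intro has_integral_mult_right has_integral_add integrable_integral iAB) (simp add: mult.commute)
  have "norm (fc (\<lambda>t. f t * cis (x * sin t)) p) \<le> integral {0..2*pi} G"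
    unfolding eq
  proof (rule Henstock_Kurzweil_Integration.integral_norm_bound_integral)
    show "(\<lambda>t. e t * cis (\<phi> t) + \<i> * (g' t * cis (\<phi> t))) integrable_on {0..2 * pi}"
      by (intro continuous_UNIV_integrable continuous_intros cg cf cd)
    show "G integrable_on {0..2 * pi}" using Gint by blast
  qed (rule bound)
  also have "\<dots> = K * ((1 / (2 * \<kappa>) + 2 * \<sigma>\<^sup>2) * (2 * pi) + (1 + \<kappa>\<^sup>2 / (x * \<sigma>)) * integral {0..2*pi} A + 2 * \<sigma> * integral {0..2*pi} B)"
    using Gint by (rule integral_unique)
  also have "\<dots> \<le> K * ((1 / (2 * \<kappa>) + 2 * \<sigma>\<^sup>2) * (2 * pi) + (1 + \<kappa>\<^sup>2 / (x * \<sigma>)) * (2 * pi / \<kappa>) + 2 * \<sigma> * (3 * pi))"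
    using integral_sin_resolvent[OF \<kappa>, of x "of_int p"] integral_cos_resolvent[OF \<sigma>] K0 x0 \<sigma> \<kappa>
    unfolding A_def [abs_def] B_def [abs_def] Q_def [abs_def] d_def [abs_def]
    by (intro mult_left_mono add_mono order_refl) auto
  also have "\<dots> \<le> K * (60 / y)"
  proof (intro mult_left_mono K0)
    \<comment> \<open>The choices \<open>\<kappa> = y^2\<close> and \<open>\<sigma> = 1 / y\<close>
      make every error term at most a multiple of \<open>1 / y\<close>; the hypothesis
      \<open>x \<ge> y ^ 4\<close> enters in
      \<open>\<kappa> / (x \<sigma>) = y^3 / x\<close>.\<close>
    have u1: "1 / \<kappa> \<le> 1 / y" unfolding \<kappa>_def using y y0 by (simp add: field_simps power2_eq_square)
    have u2: "\<sigma>\<^sup>2 \<le> 1 / y" unfolding \<sigma>_def using y y0 by (simp add: field_simps power2_eq_square)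
    have u3: "\<kappa> / (x * \<sigma>) \<le> 1 / y"
    proof -
      have "y ^ 2 * y ^ 2 \<le> x" using x by (simp add: power_add[symmetric])
      then have "\<kappa> * y\<^sup>2 \<le> x" by (simp add: \<kappa>_def)
      then show ?thesis using x0 y0 by (simp add: \<sigma>_def field_simps power2_eq_square)
    qed
    have "(1 / (2 * \<kappa>) + 2 * \<sigma>\<^sup>2) * (2 * pi) + (1 + \<kappa>\<^sup>2 / (x * \<sigma>)) * (2 * pi / \<kappa>) + 2 * \<sigma> * (3 * pi)
      = pi * (1 / \<kappa> + 4 * \<sigma>\<^sup>2 + 2 * (1 / \<kappa>) + 2 * (\<kappa> / (x * \<sigma>)) + 6 * \<sigma>)"
      using \<kappa> x0 \<sigma> by (simp add: field_simps power2_eq_square)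
    also have "\<dots> \<le> pi * (15 * (1 / y))"
      using u1 u2 u3 by (intro mult_left_mono) (auto simp: \<sigma>_def)
    also have "\<dots> \<le> 4 * (15 * (1 / y))"
      using y0 pi_less_4 by (intro mult_right_mono) auto
    finally show "(1 / (2 * \<kappa>) + 2 * \<sigma>\<^sup>2) * (2 * pi) + (1 + \<kappa>\<^sup>2 / (x * \<sigma>)) * (2 * pi / \<kappa>) + 2 * \<sigma> * (3 * pi) \<le> 60 / y"
      by simp
  qed
  finally show ?thesis by (simp add: mult.commute)
qed

section \<open>The building block\<close>

text \<open>A Moebius map with value 1 at the origin and a zero at 1. For \<open>0 < D < 1\<close>
  its pole \<open>1 / (1 - D)\<close> lies outside the disc of radius
  \<open>1 + D / 2\<close>.\<close>

definition mob :: "real \<Rightarrow> complex \<Rightarrow> complex" where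
  "mob D z = (1 - z) / (1 - of_real (1 - D) * z)"

lemma norm_one_minus_sq: "(norm (1 - of_real r * z))\<^sup>2 = 1 - 2 * r * Re z + r\<^sup>2 * (norm z)\<^sup>2"
  unfolding cmod_power2 by (simp add: algebra_simps power2_eq_square)

lemma mob_denominator:
  fixes z :: complex
  assumes D: "0 < D" "D \<le> 1/4" and z: "norm z \<le> 1 + D / 2"
  shows "1 - of_real (1 - D) * z \<noteq> 0"
proof
  assume "1 - of_real (1 - D) * z = 0"
  then have "of_real (1 - D) * z = 1" by simp
  then have "norm (of_real (1 - D) * z) = 1" by simp
  then have "(1 - D) * norm z = 1" using D unfolding norm_mult norm_of_real by simp
  moreover have "(1 - D) * norm z \<le> (1 - D) * (1 + D / 2)" using D z by (intro mult_left_mono) auto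
  moreover have "(1 - D) * (1 + D / 2) < 1" using D by (simp add: algebra_simps add_pos_pos)
  ultimately show False by linarith
qed

text \<open>The circle is slightly larger than the unit circle: by Cauchy's inequality the Taylor
  coefficients of every power \<open>L\<close> then decay geometrically at a rate independent of
  \<open>L\<close>, with loss \<open>(1 + D) ^ L\<close> only.\<close>

lemma norm_mob_le:
  assumes D: "0 < D" "D \<le> 1/4" and z: "norm z = 1 + D / 2"
  shows "norm (mob D z) \<le> 1 + D"
proof -
  define c where "c = Re z"
  have c: "c \<le> 1 + D / 2" using z complex_Re_le_cmod[of z] by (simp add: c_def)
  \<comment> \<open>The difference of the two squared moduli, expanded around the largest possible
    real part \<open>1 + D / 2\<close>, so that the linear term is visibly nonnegative.\<close>
  have "(1 + D)\<^sup>2 * (1 - 2 * (1 - D) * c + (1 - D)\<^sup>2 * (1 + D / 2)\<^sup>2) - (1 - 2 * c + (1 + D / 2)\<^sup>2)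
     = (D * (1 + D)\<^sup>2 / 2)\<^sup>2 - (D / 2)\<^sup>2 + (2 * D - 2 * D\<^sup>2 - 2 * D ^ 3) * (1 + D / 2 - c)"
    by (simp add: field_simps power2_eq_square power3_eq_cube)
  moreover have "(D / 2)\<^sup>2 \<le> (D * (1 + D)\<^sup>2 / 2)\<^sup>2"
  proof (rule power_mono)
    have "1 \<le> (1 + D)\<^sup>2" using D by (simp add: one_le_power)
    from mult_left_mono[OF this, of D] show "D / 2 \<le> D * (1 + D)\<^sup>2 / 2" using D by simp
  qed (use D in auto)
  moreover have "0 \<le> (2 * D - 2 * D\<^sup>2 - 2 * D ^ 3) * (1 + D / 2 - c)"
  proof (rule mult_nonneg_nonneg)
    have "D * D \<le> D * (1/4)" using D by (intro mult_left_mono) auto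
    moreover have "D * D * D \<le> (D * D) * (1/4)" using D by (intro mult_left_mono) auto
    ultimately show "0 \<le> 2 * D - 2 * D\<^sup>2 - 2 * D ^ 3"
      using D unfolding power2_eq_square power3_eq_cube by linarith
  qed (use c in simp)
  ultimately have "1 - 2 * c + (1 + D / 2)\<^sup>2 \<le> (1 + D)\<^sup>2 * (1 - 2 * (1 - D) * c + (1 - D)\<^sup>2 * (1 + D / 2)\<^sup>2)"
    by linarith
  moreover have "(norm (1 - z))\<^sup>2 = 1 - 2 * c + (1 + D / 2)\<^sup>2"
    using norm_one_minus_sq[of 1 z] z by (simp add: c_def)
  ultimately have "(norm (1 - z))\<^sup>2 \<le> ((1 + D) * norm (1 - of_real (1 - D) * z))\<^sup>2"
    unfolding power_mult_distrib norm_one_minus_sq z c_def by simp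
  then have "norm (1 - z) \<le> (1 + D) * norm (1 - of_real (1 - D) * z)"
    using D by (auto intro: power2_le_imp_le)
  then show ?thesis
    using mob_denominator[OF D, of z] z by (simp add: mob_def norm_divide divide_le_eq)
qed

lemma mob_power_series:
  assumes D: "0 < D" "D \<le> 1/4"
  obtains v :: "nat \<Rightarrow> complex" where "v 0 = 1"
    "\<And>k. norm (v k) \<le> (1 + D) ^ L / (1 + D / 2) ^ k"
    "\<And>z. norm z = 1 \<Longrightarrow> (\<lambda>k. v k * z ^ k) sums (mob D z ^ L)"
proof -
  define f where "f z = mob D z ^ L" for z
  have hol: "f holomorphic_on cball 0 (1 + D / 2)"
    unfolding f_def mob_def using mob_denominator[OF D]
    by (intro holomorphic_intros) auto
  then have hol': "f holomorphic_on ball 0 (1 + D / 2)" by (rule holomorphic_on_subset) auto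
  define v where "v k = (deriv ^^ k) f 0 / fact k" for k
  show ?thesis
  proof (rule that[of v])
    show "v 0 = 1" by (simp add: v_def f_def mob_def)
    have "norm ((deriv ^^ k) f 0) \<le> fact k * (1 + D) ^ L / (1 + D / 2) ^ k" for k
    proof (rule Cauchy_inequality[OF hol' holomorphic_on_imp_continuous_on[OF hol]])
      show "norm (f x) \<le> (1 + D) ^ L" if "norm (0 - x) = 1 + D / 2" for x
        unfolding f_def norm_power using that by (intro power_mono norm_mob_le[OF D]) auto
    qed (use D in auto)
    then show "norm (v k) \<le> (1 + D) ^ L / (1 + D / 2) ^ k" for k
      by (simp add: v_def norm_divide divide_le_eq mult.commute)
    show "(\<lambda>k. v k * z ^ k) sums (mob D z ^ L)" if "norm z = 1" for z
      using holomorphic_power_series[OF hol', of z] that D by (simp add: v_def f_def)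
  qed
qed

section \<open>The damping factor on the circle, its cutoff, and its expansion\<close>

definition mw :: "real \<Rightarrow> real \<Rightarrow> complex" where
  "mw D x = mob D (cis x)"

text \<open>Written through \<open>cos x\<close> to be periodic by construction. It rises from 0 to
  1 as \<open>cos x\<close> grows from \<open>1 - D^2 / 8\<close> to \<open>1 - D^2 / 16\<close>,
  that is, at distance of order \<open>D\<close> from the multiples of 2 pi.\<close>

definition cutoff :: "real \<Rightarrow> real \<Rightarrow> complex" where
  "cutoff D x = of_real (bump ((cos x - (1 - D\<^sup>2 / 8)) * (16 / D\<^sup>2)))"

lemma psmooth_mw:
  assumes D: "0 < D" "D \<le> 1/4"
  shows "psmooth (mw D)"
proof -
  have "smooth (\<lambda>x. (1 - cis x) * inverse (1 - of_real (1 - D) * cis x))"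
    using D by (intro smooth_intros smooth_inverse smooth_cis mob_denominator) auto
  then show ?thesis
    by (simp add: psmooth_def periodic_def mw_def [abs_def] mob_def divide_inverse cis.code)
qed

lemma psmooth_cutoff: "psmooth (cutoff D)"
proof -
  have "smooth (cutoff D)"
    unfolding cutoff_def [abs_def]
    by (intro smooth_of_real smooth_compose[OF smooth_bump] smooth_mult smooth_diff smooth_cos smooth_const)
  then show ?thesis by (simp add: psmooth_def periodic_def cutoff_def)
qed

lemma cutoff_eq_1:
  assumes "0 < D" "cos x \<ge> 1 - D\<^sup>2 / 16"
  shows "cutoff D x = 1"
proof -
  have "1 = (D\<^sup>2 / 16) * (16 / D\<^sup>2)" using assms by simp
  also have "\<dots> \<le> (cos x - (1 - D\<^sup>2 / 8)) * (16 / D\<^sup>2)" using assms by (intro mult_right_mono) auto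
  finally show ?thesis by (simp add: cutoff_def bump_eq_1)
qed

text \<open>Where the cutoff may be nonzero, \<open>|1 - z|\<close> is at most \<open>D / 2\<close>,
  while the denominator of the Moebius map is at least \<open>D\<close> on the unit circle; the
  quotient is therefore at most 1/2.\<close>

lemma cutoff_eq_0:
  assumes D: "0 < D" "D \<le> 1/4" and x: "1/2 < norm (mw D x)"
  shows "cutoff D x = 0"
proof (cases "cos x \<le> 1 - D\<^sup>2 / 8")
  case True
  then have "(cos x - (1 - D\<^sup>2 / 8)) * (16 / D\<^sup>2) \<le> 0" by (intro mult_nonpos_nonneg) auto
  then show ?thesis by (simp add: cutoff_def bump_eq_0)
next
  case False
  have "(norm (1 - cis x))\<^sup>2 = 2 - 2 * cos x" using norm_one_minus_sq[of 1 "cis x"] by simp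
  also have "\<dots> \<le> (D / 2)\<^sup>2" using False by (simp add: power2_eq_square)
  finally have 1: "norm (1 - cis x) \<le> D / 2" by (rule power2_le_imp_le) (use D in simp)
  have "D \<le> norm (1 - of_real (1 - D) * cis x)"
    using norm_triangle_ineq2[of 1 "of_real (1 - D) * cis x"] D
    unfolding norm_mult norm_of_real norm_cis by simp
  then have "norm (mw D x) \<le> (D / 2) / D"
    unfolding mw_def mob_def norm_divide using 1 D by (intro frac_le) auto
  then show ?thesis using x D by simp
qed

text \<open>The linear part of the phase shifts the frequency by \<open>k M^2\<close>, the constant
  \<open>\<theta>\<close> contributes a unimodular factor, and only the chirp with parameter
  \<open>k M\<close> remains.\<close>

lemma fc_phase_power:
  "norm (fc (\<lambda>t. f t * cis (phase M \<theta> t) ^ k) n) =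
    norm (fc (\<lambda>t. f t * cis (real k * real M * sin t)) (n - int k * (int M)\<^sup>2))"
proof -
  have "f t * cis (phase M \<theta> t) ^ k = cis (real k * \<theta>) * (cis (of_int (int k * (int M)\<^sup>2) * t) * (f t * cis (real k * real M * sin t)))" for t
  proof -
    have "real k * phase M \<theta> t = real k * \<theta> + (of_int (int k * (int M)\<^sup>2) * t + real k * real M * sin t)"
      by (simp add: phase_def algebra_simps)
    then have "cis (phase M \<theta> t) ^ k = cis (real k * \<theta>) * (cis (of_int (int k * (int M)\<^sup>2) * t) * cis (real k * real M * sin t))"
      unfolding Complex.DeMoivre cis_mult by simp
    then show ?thesis by simp
  qed
  then show ?thesis by (simp only: fc_cmult fc_cis norm_mult norm_cis mult_1_left)
qed

text \<open>The power series of \<open>w^L\<close> has constant term 1, so subtracting 1 leaves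
  positive powers of the carrier only. Uniform convergence on the unit circle allows termwise
  integration, and the Cauchy bounds weight the individual estimates \<open>\<beta>\<close>.\<close>

lemma fc_series_bound:
  assumes D: "0 < D" "D \<le> 1/4"
    and f: "continuous_on UNIV f" "\<And>t. norm (f t) \<le> K"
    and \<beta>: "\<And>k. norm (fc (\<lambda>t. f t * cis (phase M \<theta> t) ^ Suc k) n) \<le> \<beta> k"
    and sum: "summable (\<lambda>k. \<beta> k / (1 + D / 2) ^ Suc k)"
  shows "norm (fc (\<lambda>t. f t * (mw D (phase M \<theta> t) ^ L - 1)) n) \<le> (1 + D) ^ L * (\<Sum>k. \<beta> k / (1 + D / 2) ^ Suc k)"
proof -
  obtain v :: "nat \<Rightarrow> complex" where v: "v 0 = 1"
    "\<And>k. norm (v k) \<le> (1 + D) ^ L / (1 + D / 2) ^ k"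
    "\<And>z. norm z = 1 \<Longrightarrow> (\<lambda>k. v k * z ^ k) sums (mob D z ^ L)"
    using mob_power_series[OF D] by blast
  have K: "K \<ge> 0" using f(2)[of 0] norm_ge_zero order_trans by blast
  let ?c = "\<lambda>t. cis (phase M \<theta> t)" and ?e = "\<lambda>t. cis (- (real_of_int n * t))"
  define h where "h k t = v (Suc k) * (f t * ?c t ^ Suc k * ?e t)" for k t
  define m where "m k = (1 + D) ^ L / (1 + D / 2) ^ Suc k * K" for k
  have cph: "continuous_on A (phase M \<theta>)" for A by (rule smooth_imp_continuous[OF smooth_phase])
  have cf: "continuous_on A f" for A using f(1) continuous_on_subset by blast
  have ch: "continuous_on A (h k)" for A k unfolding h_def by (intro continuous_intros cph cf)
  have "norm (h k t) \<le> m k" for k t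
  proof -
    have "norm (h k t) = norm (v (Suc k)) * norm (f t)" by (simp add: h_def norm_mult norm_power)
    also have "\<dots> \<le> m k" unfolding m_def using D by (intro mult_mono f(2) v(2)) auto
    finally show ?thesis .
  qed
  moreover have "summable m"
  proof -
    have "summable (\<lambda>k. ((1 + D) ^ L * K) * (1 / (1 + D / 2)) ^ Suc k)"
      using D by (intro summable_mult) (simp add: summable_geometric)
    then show ?thesis by (simp add: m_def [abs_def] power_divide mult_ac)
  qed
  ultimately have "uniform_limit {0..2 * pi} (\<lambda>N t. \<Sum>k<N. h k t) (\<lambda>t. \<Sum>k. h k t) sequentially"
    by (intro Weierstrass_m_test)
  moreover have "(\<Sum>k. h k t) = f t * (mw D (phase M \<theta> t) ^ L - 1) * ?e t" for t
  proof -
    have "(\<lambda>k. v (Suc k) * ?c t ^ Suc k) sums (mob D (?c t) ^ L - 1)"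
      using v(3)[of "?c t"] v(1) sums_Suc_iff[of "\<lambda>k. v k * ?c t ^ k" "mob D (?c t) ^ L - 1"] by simp
    from sums_mult[OF this, of "f t * ?e t"]
    have "(\<lambda>k. h k t) sums (f t * (mw D (phase M \<theta> t) ^ L - 1) * ?e t)"
      unfolding h_def mw_def by (simp only: mult_ac)
    then show ?thesis by (rule sums_unique[symmetric])
  qed
  ultimately have ul: "uniform_limit {0..2 * pi} (\<lambda>N t. \<Sum>k<N. h k t) (\<lambda>t. f t * (mw D (phase M \<theta> t) ^ L - 1) * ?e t) sequentially"
    by simp
  have cs: "continuous_on {0..2 * pi} (\<lambda>t. \<Sum>k<N. h k t)" for N
    by (intro continuous_on_sum ch)
  obtain I J where IJ: "\<And>N. ((\<lambda>t. \<Sum>k<N. h k t) has_integral I N) {0..2 * pi}"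
    "((\<lambda>t. f t * (mw D (phase M \<theta> t) ^ L - 1) * ?e t) has_integral J) {0..2 * pi}" "I \<longlonglongrightarrow> J"
    using uniform_limit_integral[OF ul cs sequentially_bot] by blast
  have J: "J = fc (\<lambda>t. f t * (mw D (phase M \<theta> t) ^ L - 1)) n"
    unfolding fc_def using IJ(2) by (simp add: integral_unique)
  have "I N = (\<Sum>k<N. v (Suc k) * fc (\<lambda>t. f t * ?c t ^ Suc k) n)" for N
  proof -
    have "I N = integral {0..2*pi} (\<lambda>t. \<Sum>k<N. h k t)" using integral_unique[OF IJ(1)[of N]] by simp
    also have "\<dots> = (\<Sum>k<N. integral {0..2*pi} (h k))"
      by (intro Henstock_Kurzweil_Integration.integral_sum integrable_continuous_interval ch) auto
    finally show ?thesis by (simp add: h_def [abs_def] fc_def)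
  qed
  moreover have "norm (\<Sum>k<N. v (Suc k) * fc (\<lambda>t. f t * ?c t ^ Suc k) n) \<le> (1 + D) ^ L * (\<Sum>k. \<beta> k / (1 + D / 2) ^ Suc k)" for N
  proof -
    have \<beta>0: "\<beta> k \<ge> 0" for k using \<beta>[of k] norm_ge_zero order_trans by blast
    have "norm (\<Sum>k<N. v (Suc k) * fc (\<lambda>t. f t * ?c t ^ Suc k) n) \<le> (\<Sum>k<N. (1 + D) ^ L / (1 + D / 2) ^ Suc k * \<beta> k)"
    proof (rule sum_norm_le)
      fix k
      show "norm (v (Suc k) * fc (\<lambda>t. f t * ?c t ^ Suc k) n) \<le> (1 + D) ^ L / (1 + D / 2) ^ Suc k * \<beta> k"
        unfolding norm_mult using D by (intro mult_mono v(2) \<beta>) auto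
    qed
    also have "\<dots> = (1 + D) ^ L * (\<Sum>k<N. \<beta> k / (1 + D / 2) ^ Suc k)"
      by (simp add: sum_distrib_left mult_ac)
    also have "\<dots> \<le> (1 + D) ^ L * (\<Sum>k. \<beta> k / (1 + D / 2) ^ Suc k)"
      using D \<beta>0 by (intro mult_left_mono sum_le_suminf sum) auto
    finally show ?thesis .
  qed
  ultimately have "norm (I N) \<le> (1 + D) ^ L * (\<Sum>k. \<beta> k / (1 + D / 2) ^ Suc k)" for N by simp
  then have "norm J \<le> (1 + D) ^ L * (\<Sum>k. \<beta> k / (1 + D / 2) ^ Suc k)"
    by (intro Lim_norm_ubound[OF _ IJ(3)]) auto
  then show ?thesis by (simp only: J)
qed

section \<open>Auxiliary series and bounds for periodic functions of class C^1\<close>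

lemma summable_power_geometric:
  fixes x :: real
  assumes "\<bar>x\<bar> < 1"
  shows "summable (\<lambda>k. real (Suc k) ^ a * x ^ k)"
proof -
  have "0 \<le> x \<Longrightarrow> x < 1 \<Longrightarrow> summable (\<lambda>k. real (Suc k) ^ a * x ^ k)" for x
  proof (induction a arbitrary: x)
    case 0
    then show ?case by (simp add: summable_geometric)
  next
    case (Suc a)
    \<comment> \<open>Termwise differentiation produces the coefficients
      \<open>(n + 1) (n + 2) ^ a\<close>, which dominate \<open>(n + 1) ^ (a + 1)\<close>.\<close>
    have "summable (\<lambda>n. diffs (\<lambda>k. real (Suc k) ^ a) n * x ^ n)"
    proof (rule termdiff_converges[where K = 1])
      fix y :: real
      assume "norm y < 1"
      then have "summable (\<lambda>k. real (Suc k) ^ a * \<bar>y\<bar> ^ k)" using Suc.IH[of "\<bar>y\<bar>"] by simp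
      then have "summable (\<lambda>k. norm (real (Suc k) ^ a * y ^ k))" by (simp add: abs_mult power_abs)
      then show "summable (\<lambda>k. real (Suc k) ^ a * y ^ k)" by (rule summable_norm_cancel)
    qed (use Suc.prems in simp)
    then show ?case
    proof (rule summable_comparison_test')
      fix n
      have "real (Suc n) ^ Suc a \<le> real (Suc n) * real (Suc (Suc n)) ^ a"
        unfolding power_Suc by (intro mult_left_mono power_mono) auto
      then have "real (Suc n) ^ Suc a * x ^ n \<le> diffs (\<lambda>k. real (Suc k) ^ a) n * x ^ n"
        unfolding diffs_def using Suc.prems by (intro mult_right_mono) auto
      then show "norm (real (Suc n) ^ Suc a * x ^ n) \<le> diffs (\<lambda>k. real (Suc k) ^ a) n * x ^ n"
        using Suc.prems by (simp add: abs_mult)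
    qed
  qed
  from this[of "\<bar>x\<bar>"] have "summable (\<lambda>k. norm (real (Suc k) ^ a * x ^ k))"
    using assms by (simp add: abs_mult power_abs)
  then show ?thesis by (rule summable_norm_cancel)
qed

text \<open>A C^1 norm bound with one constant for the function and its derivative. The multipliers
  used for localisation are constructed as C^1 functions, so the coefficient estimates are phrased
  for this class.\<close>

definition C1_le :: "(real \<Rightarrow> complex) \<Rightarrow> real \<Rightarrow> bool" where
  "C1_le l K \<longleftrightarrow> periodic l \<and> (\<forall>t. norm (l t) \<le> K) \<and>
     (\<exists>l'. (\<forall>t. (l has_vector_derivative l' t) (at t)) \<and> continuous_on UNIV l' \<and> (\<forall>t. norm (l' t) \<le> K))"

lemma C1_le_continuous: "C1_le l K \<Longrightarrow> continuous_on UNIV l"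
  unfolding C1_le_def using continuous_on_UNIV_if_deriv by blast

lemma Ck_imp_C1_le:
  assumes "Ck (Suc 0) f" "periodic f"
  obtains K where "K > 0" "C1_le f K"
proof -
  obtain f' where f': "\<forall>x. (f has_vector_derivative f' x) (at x)" "continuous_on UNIV f'"
    using assms(1) by auto
  obtain K1 where K1: "K1 > 0" "\<And>t. norm (f t) \<le> K1"
    by (rule periodic_bounded[OF Ck_imp_continuous[OF assms(1)] assms(2)]) blast
  have "periodic f'" using periodic_deriv[of f f'] assms(2) f'(1) by blast
  from periodic_bounded[OF f'(2) this]
  obtain K2 where K2: "K2 > 0" "\<And>t. norm (f' t) \<le> K2" by blast
  have "norm (f t) \<le> max K1 K2" "norm (f' t) \<le> max K1 K2" for t
    using K1(2)[of t] K2(2)[of t] by linarith+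
  then have "C1_le f (max K1 K2)" using assms(2) f' unfolding C1_le_def by blast
  then show ?thesis using that[of "max K1 K2"] K1(1) by linarith
qed

lemma psmooth_C1_le:
  assumes "psmooth S"
  obtains K where "K > 0" "C1_le S K"
  by (rule Ck_imp_C1_le[of S]) (use assms in \<open>auto simp: psmooth_def smooth_def simp del: Ck.simps\<close>)

lemma C1_le_mult:
  assumes "C1_le f A" "C1_le g B"
  shows "C1_le (\<lambda>t. f t * g t) (2 * A * B)"
proof -
  obtain f' where f': "\<forall>t. (f has_vector_derivative f' t) (at t)" "continuous_on UNIV f'" "\<forall>t. norm (f' t) \<le> A"
    using assms(1) unfolding C1_le_def by blast
  obtain g' where g': "\<forall>t. (g has_vector_derivative g' t) (at t)" "continuous_on UNIV g'" "\<forall>t. norm (g' t) \<le> B"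
    using assms(2) unfolding C1_le_def by blast
  have n: "norm (f t) \<le> A" "norm (g t) \<le> B" for t using assms by (auto simp: C1_le_def)
  have A: "A \<ge> 0" using n(1)[of 0] norm_ge_zero order_trans by blast
  have m: "norm (x * y) \<le> A * B" if "norm x \<le> A" "norm y \<le> B" for x y :: complex
    unfolding norm_mult using that A by (intro mult_mono) auto
  have "0 \<le> A * B" using m[OF n(1) n(2), of 0 0] norm_ge_zero order_trans by blast
  then have "norm (f t * g t) \<le> 2 * A * B" for t using m[OF n(1) n(2), of t t] by linarith
  moreover have "norm (f t * g' t + f' t * g t) \<le> 2 * A * B" for t
    using norm_triangle_le[OF add_mono[OF m[OF n(1)[of t], of "g' t"] m[OF _ n(2)[of t], of "f' t"]]] f'(3) g'(3) by simp
  moreover have "\<forall>t. ((\<lambda>t. f t * g t) has_vector_derivative (f t * g' t + f' t * g t)) (at t)"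
    using f'(1) g'(1) by (blast intro: has_vector_derivative_mult)
  moreover have "continuous_on UNIV (\<lambda>t. f t * g' t + f' t * g t)"
    by (intro continuous_intros f' g' C1_le_continuous[OF assms(1)] C1_le_continuous[OF assms(2)])
  moreover have "periodic (\<lambda>t. f t * g t)" using assms by (auto simp: C1_le_def periodic_def)
  ultimately show ?thesis unfolding C1_le_def
    by (intro conjI allI exI[of _ "\<lambda>t. f t * g' t + f' t * g t"]) auto
qed

lemma fc_C1_vdCorput:
  assumes "C1_le f K" "y \<ge> 1" "x \<ge> y ^ 4"
  shows "norm (fc (\<lambda>t. f t * cis (x * sin t)) p) \<le> 60 * K / y"
  using assms fc_phase_vdCorput[of f _ K y x p] unfolding C1_le_def by blast

text \<open>For \<open>n < 0\<close> the shift moves the frequency further from 0, to distance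
  \<open>q + k M^2\<close>. Of its \<open>2 a + 1\<close> powers, \<open>a\<close> go to
  \<open>q\<close> and \<open>a + 1\<close> to \<open>k M^2\<close>; against the chirp cost
  \<open>(k M) ^ (2 a + 1)\<close> this leaves \<open>k ^ a\<close> and a gain \<open>1 / M\<close>.
  The exponent \<open>2 a + 1\<close> is the smallest that leaves such a gain.\<close>

lemma negative_coefficient_arith:
  fixes q k M N C :: real
  assumes q: "q \<ge> 1" and k: "k \<ge> 1" and M: "M \<ge> 1" and N: "N \<ge> 0" and C: "C \<ge> 0"
    and le: "(q + k * M\<^sup>2) ^ (2 * a + 1) * N \<le> C * (1 + k * M) ^ (2 * a + 1)"
  shows "N \<le> C * 2 ^ (2 * a + 1) * k ^ a / (q ^ a * M)"
proof -
  define X where "X = (k * M\<^sup>2) ^ (a + 1)"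
  have kM: "k * M \<ge> 1" using mult_mono[of 1 k 1 M] k M by simp
  have X: "X > 0" using k M by (simp add: X_def)
  have "q ^ a * X \<le> (q + k * M\<^sup>2) ^ a * (q + k * M\<^sup>2) ^ (a + 1)"
    unfolding X_def using q k M by (intro mult_mono power_mono) auto
  also have "\<dots> = (q + k * M\<^sup>2) ^ (2 * a + 1)" by (simp add: power_add[symmetric] mult_2)
  finally have "q ^ a * X * N \<le> (q + k * M\<^sup>2) ^ (2 * a + 1) * N" using N by (intro mult_right_mono) auto
  also have "\<dots> \<le> C * (1 + k * M) ^ (2 * a + 1)" by (rule le)
  also have "\<dots> \<le> C * (2 * (k * M)) ^ (2 * a + 1)"
    by (intro mult_left_mono power_mono) (use C kM in linarith)+
  finally have "q ^ a * X * N * M \<le> C * (2 * (k * M)) ^ (2 * a + 1) * M" using M by (intro mult_right_mono) auto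
  also have "\<dots> = C * 2 ^ (2 * a + 1) * k ^ a * X"
  proof -
    have "X = k ^ (a + 1) * M ^ (2 * (a + 1))" unfolding X_def power_mult_distrib power_mult ..
    moreover have "k ^ (2 * a + 1) = k ^ a * k ^ (a + 1)" by (simp add: power_add[symmetric] mult_2)
    moreover have "M ^ (2 * (a + 1)) = M ^ (2 * a + 1) * M" by simp
    ultimately show ?thesis unfolding power_mult_distrib by (simp only: mult_ac)
  qed
  finally have "(q ^ a * M * N) * X \<le> (C * 2 ^ (2 * a + 1) * k ^ a) * X" by (simp add: mult_ac)
  then have "q ^ a * M * N \<le> C * 2 ^ (2 * a + 1) * k ^ a" using X by simp
  moreover have "q ^ a * M > 0" using q M by simp
  ultimately show ?thesis by (simp add: pos_le_divide_eq mult_ac)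
qed

section \<open>Fourier coefficients of one damping\<close>

definition damp :: "real \<Rightarrow> nat \<Rightarrow> nat \<Rightarrow> real \<Rightarrow> (real \<Rightarrow> complex) \<Rightarrow> real \<Rightarrow> complex" where
  "damp D L M \<theta> S t = S t * (mw D (phase M \<theta> t) ^ L * (1 - cutoff D (phase M \<theta> t)))"

text \<open>The same \<open>L\<close> and \<open>M\<close> work for all \<open>\<theta>\<close>, so
  the shift stays free and can later be adapted to the support. The multiplier \<open>l\<close> is
  carried along for localisation; the fast decay is claimed for negative frequencies without a
  multiplier.\<close>

lemma damp_coefficients:
  assumes S: "psmooth S" and \<epsilon>: "\<epsilon> > 0" and D_def: "D = 1 / (4 * real (12 * a + 1))"
  obtains L M where "M \<ge> 1"
    "\<And>\<theta> l K n. C1_le l K \<Longrightarrow> norm (fc (\<lambda>t. (damp D L M \<theta> S t - S t) * l t) n) \<le> \<epsilon> * K"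
    "\<And>\<theta> n. n < 0 \<Longrightarrow> \<bar>of_int n\<bar> ^ a * norm (fc (\<lambda>t. damp D L M \<theta> S t - S t) n) \<le> \<epsilon>"
proof -
  \<comment> \<open>With \<open>M = 16\<^sup>h\<close> and \<open>L = \<Lambda> h\<close>, the factor \<open>2\<^sup>-\<^sup>L\<close> must beat \<open>((1 + L) M\<^sup>2)\<^sup>a\<close>, which is of order at most \<open>2\<^sup>9\<^sup>a\<^sup>h\<close>.\<close>
  define \<Lambda> where "\<Lambda> = 12 * a + 1"
  have \<Lambda>: "\<Lambda> \<ge> 1" by (simp add: \<Lambda>_def)
  have D: "0 < D" "D \<le> 1/4" by (auto simp: D_def field_simps)
  \<comment> \<open>\<open>D\<close> is \<open>1 / (4 \<Lambda>)\<close>, so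
    \<open>\<Lambda>\<close> factors \<open>1 + D\<close> amount to at most exp(1/4). Thus
    \<open>(1 + D) ^ L\<close> grows at most like \<open>(3/2) ^ h\<close>.\<close>
  have D1: "(1 + D) ^ \<Lambda> \<le> 3 / 2"
  proof -
    have "(1 + D) ^ \<Lambda> \<le> exp D ^ \<Lambda>" using D exp_ge_add_one_self[of D] by (intro power_mono) auto
    also have "\<dots> = exp (real \<Lambda> * D)" by (simp add: exp_of_nat_mult)
    also have "real \<Lambda> * D = 1 / 4" by (simp add: D_def \<Lambda>_def field_simps)
    also have "exp (1/4 :: real) \<le> 1 + 1/4 + (1/4)\<^sup>2" by (rule exp_bound) auto
    also have "\<dots> \<le> 3 / 2" by (simp add: power2_eq_square)
    finally show ?thesis .
  qed
  define R where "R = 1 + D / 2"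
  have R: "R > 1" using D by (simp add: R_def)
  define G where "G b = (\<Sum>k. real (Suc k) ^ b / R ^ Suc k)" for b
  have sumG: "summable (\<lambda>k. real (Suc k) ^ b / R ^ Suc k)" for b
  proof -
    have "summable (\<lambda>k. (1 / R) * (real (Suc k) ^ b * (1 / R) ^ k))"
      using R by (intro summable_mult summable_power_geometric) auto
    then show ?thesis by (simp add: power_divide)
  qed
  have G0: "G b \<ge> 0" for b unfolding G_def using R by (intro suminf_nonneg sumG) auto
  obtain K1 where K1: "K1 > 0" "C1_le S K1" by (rule psmooth_C1_le[OF S])
  obtain Kb where Kb: "Kb > 0" "\<And>t. norm (cutoff D t) \<le> Kb" by (rule psmooth_bounded[OF psmooth_cutoff[of D]]) blast
  obtain CB where CB: "CB \<ge> 0" "\<And>x p. x \<ge> 0 \<Longrightarrow> \<bar>of_int p\<bar> ^ (2 * a + 1) * norm (fc (\<lambda>t. S t * cis (x * sin t)) p) \<le> CB * (1 + x) ^ (2 * a + 1)"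
    using fc_phase_decay[OF S, of "2 * a + 1"] by blast
  obtain CC where CC: "CC \<ge> 0" "\<And>L M \<theta> n. M \<ge> 1 \<Longrightarrow>
      \<bar>of_int n\<bar> ^ a * norm (fc (\<lambda>t. S t * (mw D (phase M \<theta> t) ^ L * cutoff D (phase M \<theta> t))) n)
      \<le> CC * ((1 + real L) * (real M)\<^sup>2) ^ a * (1/2) ^ L"
    using fc_compose_power_decay[OF psmooth_mw[OF D] _ S psmooth_cutoff cutoff_eq_0[OF D], of "1/2" a] by auto
  \<comment> \<open>\<open>E1\<close> and \<open>E2\<close> gather the constants of the two
    estimates; every contribution will carry the factor \<open>(3/4) ^ h\<close>, so one
    \<open>h\<close> serves both.\<close>
  define E1 where "E1 = 120 * K1 * G 0 + 2 * pi * K1 * Kb"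
  define E2 where "E2 = CB * 2 ^ (2 * a + 1) * G a + CC * real \<Lambda> ^ a"
  have E: "E1 \<ge> 0" "E2 \<ge> 0" unfolding E1_def E2_def using K1(1) Kb(1) G0 CB(1) CC(1) by auto
  have "(\<lambda>h. (E1 + E2) * (3/4 :: real) ^ h) \<longlonglongrightarrow> (E1 + E2) * 0"
    by (intro tendsto_intros LIMSEQ_realpow_zero) auto
  then have "\<forall>\<^sub>F h in sequentially. (E1 + E2) * (3/4 :: real) ^ h < \<epsilon>"
    using \<epsilon> by (simp add: order_tendsto_iff)
  then obtain h where h: "(E1 + E2) * (3/4 :: real) ^ h < \<epsilon>"
    unfolding eventually_sequentially by blast
  define L where "L = \<Lambda> * h"
  define M :: nat where "M = 16 ^ h"
  have M: "M \<ge> 1" by (simp add: M_def)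
  have M4: "real M = (2 ^ h) ^ 4" by (simp add: M_def power_mult[symmetric] mult.commute[of h]) (simp add: power_mult)
  have DL: "(1 + D) ^ L \<le> (3/2) ^ h"
    unfolding L_def power_mult using D D1 by (intro power_mono) auto
  have hL: "h \<le> L" using \<Lambda> by (simp add: L_def)
  have half: "(1/2 :: real) ^ L \<le> (3/4) ^ h"
  proof -
    have "(1/2 :: real) ^ L \<le> (1/2) ^ h" using hL by (intro power_decreasing) auto
    also have "\<dots> \<le> (3/4) ^ h" by (intro power_mono) auto
    finally show ?thesis .
  qed
  have cSM: "continuous_on UNIV (\<lambda>t. S t * l t * (mw D (phase M \<theta> t) ^ L - 1))"
    "continuous_on UNIV (\<lambda>t. S t * l t * (mw D (phase M \<theta> t) ^ L * cutoff D (phase M \<theta> t)))"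
    if "continuous_on UNIV l" for l \<theta>
  proof -
    have "psmooth (\<lambda>t. S t * (mw D (phase M \<theta> t) ^ L - 1))" "psmooth (\<lambda>t. S t * (mw D (phase M \<theta> t) ^ L * cutoff D (phase M \<theta> t)))"
      by (intro psmooth_mult psmooth_diff psmooth_const psmooth_power psmooth_compose_phase S psmooth_mw[OF D] psmooth_cutoff)+
    then have "smooth (\<lambda>t. S t * (mw D (phase M \<theta> t) ^ L - 1))" "smooth (\<lambda>t. S t * (mw D (phase M \<theta> t) ^ L * cutoff D (phase M \<theta> t)))"
      by (simp_all add: psmooth_def)
    from this[THEN smooth_imp_continuous, of UNIV, THEN continuous_on_mult[OF that]]
    show "continuous_on UNIV (\<lambda>t. S t * l t * (mw D (phase M \<theta> t) ^ L - 1))"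
    "continuous_on UNIV (\<lambda>t. S t * l t * (mw D (phase M \<theta> t) ^ L * cutoff D (phase M \<theta> t)))"
      by (simp_all add: mult_ac)
  qed
  \<comment> \<open>The first piece contains positive powers of the carrier only; the second is
    supported where \<open>mw\<close> is at most 1/2 in modulus. They are small for different
    reasons.\<close>
  have split: "fc (\<lambda>t. (damp D L M \<theta> S t - S t) * l t) n =
      fc (\<lambda>t. S t * l t * (mw D (phase M \<theta> t) ^ L - 1)) n
      - fc (\<lambda>t. S t * l t * (mw D (phase M \<theta> t) ^ L * cutoff D (phase M \<theta> t))) n"
    if "continuous_on UNIV l" for l \<theta> n
    unfolding fc_diff[OF cSM[OF that], symmetric] damp_def by (simp add: algebra_simps)
  show ?thesis
  proof (rule that[of M L])
    show "M \<ge> 1" by (rule M)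
  next
    fix \<theta> l K n
    assume l: "C1_le l K"
    have K: "K \<ge> 0" using l norm_ge_zero order_trans unfolding C1_le_def by blast
    have f: "C1_le (\<lambda>t. S t * l t) (2 * K1 * K)" using C1_le_mult[OF K1(2) l] .
    \<comment> \<open>The chirp bound is applied with \<open>y = 2 ^ h\<close>, admissible for every
      \<open>k\<close> because \<open>M\<close> is its fourth power. The gain \<open>2 ^ h\<close>
      beats the loss \<open>(3/2) ^ h\<close>.\<close>
    let ?B = "60 * (2 * K1 * K) / 2 ^ h"
    have "norm (fc (\<lambda>t. S t * l t * (mw D (phase M \<theta> t) ^ L - 1)) n) \<le> (1 + D) ^ L * (\<Sum>k. ?B / (1 + D / 2) ^ Suc k)"
    proof (rule fc_series_bound[OF D C1_le_continuous[OF f]])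
      show "norm (S t * l t) \<le> 2 * K1 * K" for t using f by (simp add: C1_le_def)
      show "norm (fc (\<lambda>t. S t * l t * cis (phase M \<theta> t) ^ Suc k) n) \<le> ?B" for k
        unfolding fc_phase_power
      proof (rule fc_C1_vdCorput[OF f])
        show "(2 ^ h) ^ 4 \<le> real (Suc k) * real M" unfolding M4[symmetric] by (simp add: algebra_simps)
      qed simp
      show "summable (\<lambda>k. ?B / (1 + D / 2) ^ Suc k)"
        using summable_mult[OF sumG[of 0], of ?B] by (simp add: R_def)
    qed
    also have "(\<Sum>k. ?B / (1 + D / 2) ^ Suc k) = ?B * G 0"
      using suminf_mult[OF sumG[of 0], of ?B] by (simp add: R_def G_def)
    also have "(1 + D) ^ L * (?B * G 0) \<le> (3/2) ^ h * (?B * G 0)"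
      using DL K K1(1) G0 by (intro mult_right_mono) auto
    also have "\<dots> = 120 * K1 * G 0 * K * (3/4) ^ h"
    proof -
      have "(3/2 :: real) ^ h / 2 ^ h = (3/4) ^ h" by (simp add: power_divide[symmetric])
      moreover have "(3/2) ^ h * (?B * G 0) = 120 * K1 * G 0 * K * ((3/2) ^ h / 2 ^ h)" by simp
      ultimately show ?thesis by simp
    qed
    finally have 1: "norm (fc (\<lambda>t. S t * l t * (mw D (phase M \<theta> t) ^ L - 1)) n) \<le> 120 * K1 * G 0 * K * (3/4) ^ h" .
    have "norm (fc (\<lambda>t. S t * l t * (mw D (phase M \<theta> t) ^ L * cutoff D (phase M \<theta> t))) n) \<le> 2 * pi * (K1 * K * ((1/2) ^ L * Kb))"
    proof (rule fc_norm_le[OF cSM(2)[OF C1_le_continuous[OF l]]])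
      fix t
      have "norm (mw D x ^ L * cutoff D x) \<le> (1/2) ^ L * Kb" for x
      proof (cases "1/2 < norm (mw D x)")
        case True
        then show ?thesis using cutoff_eq_0[OF D] Kb(1) by simp
      next
        case False
        then show ?thesis unfolding norm_mult norm_power using Kb
          by (intro mult_mono power_mono) auto
      qed
      moreover have "norm (S t) \<le> K1" "norm (l t) \<le> K" using K1(2) l by (auto simp: C1_le_def)
      ultimately show "norm (S t * l t * (mw D (phase M \<theta> t) ^ L * cutoff D (phase M \<theta> t))) \<le> K1 * K * ((1/2) ^ L * Kb)"
        unfolding norm_mult[of "S t * l t"] norm_mult[of "S t"] using K1(1) K by (intro mult_mono) auto
    qed
    also have "\<dots> \<le> 2 * pi * (K1 * K * ((3/4) ^ h * Kb))"
      using half K1(1) K Kb(1) by (intro mult_left_mono mult_right_mono) auto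
    also have "\<dots> = 2 * pi * K1 * Kb * K * (3/4) ^ h" by simp
    finally have 2: "norm (fc (\<lambda>t. S t * l t * (mw D (phase M \<theta> t) ^ L * cutoff D (phase M \<theta> t))) n) \<le> 2 * pi * K1 * Kb * K * (3/4) ^ h" .
    have "norm (fc (\<lambda>t. (damp D L M \<theta> S t - S t) * l t) n) \<le> 120 * K1 * G 0 * K * (3/4) ^ h + 2 * pi * K1 * Kb * K * (3/4) ^ h"
      unfolding split[OF C1_le_continuous[OF l]] using norm_triangle_ineq4 1 2 by (meson add_mono order_trans)
    also have "\<dots> = E1 * (3/4) ^ h * K" by (simp add: E1_def algebra_simps)
    also have "\<dots> \<le> \<epsilon> * K"
    proof (rule mult_right_mono[OF _ K])
      have "E1 * (3/4) ^ h \<le> (E1 + E2) * (3/4) ^ h" using E by (intro mult_right_mono) auto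
      then show "E1 * (3/4) ^ h \<le> \<epsilon>" using h by linarith
    qed
    finally show "norm (fc (\<lambda>t. (damp D L M \<theta> S t - S t) * l t) n) \<le> \<epsilon> * K" .
  next
    fix \<theta> and n :: int
    assume n: "n < 0"
    define q where "q = \<bar>real_of_int n\<bar>"
    have q: "q \<ge> 1" using n by (simp add: q_def)
    let ?B = "\<lambda>k. CB * 2 ^ (2 * a + 1) * real (Suc k) ^ a / (q ^ a * real M)"
    let ?c = "CB * 2 ^ (2 * a + 1) / (q ^ a * real M)"
    have "norm (fc (\<lambda>t. S t * (mw D (phase M \<theta> t) ^ L - 1)) n) \<le> (1 + D) ^ L * (\<Sum>k. ?B k / (1 + D / 2) ^ Suc k)"
    proof (rule fc_series_bound[OF D C1_le_continuous[OF K1(2)]])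
      show "norm (S t) \<le> K1" for t using K1(2) by (simp add: C1_le_def)
      show "norm (fc (\<lambda>t. S t * cis (phase M \<theta> t) ^ Suc k) n) \<le> ?B k" for k
        unfolding fc_phase_power
      proof (rule negative_coefficient_arith)
        have "\<bar>of_int (n - int (Suc k) * (int M)\<^sup>2)\<bar> = q + real (Suc k) * (real M)\<^sup>2"
        proof -
          have "of_int (n - int (Suc k) * (int M)\<^sup>2) = real_of_int n - real (Suc k) * (real M)\<^sup>2" by simp
          moreover have "real_of_int n < 0" "0 \<le> real (Suc k) * (real M)\<^sup>2" using n by auto
          ultimately show ?thesis unfolding q_def by linarith
        qed
        with CB(2)[of "real (Suc k) * real M" "n - int (Suc k) * (int M)\<^sup>2"]
        show "(q + real (Suc k) * (real M)\<^sup>2) ^ (2 * a + 1) * norm (fc (\<lambda>t. S t * cis (real (Suc k) * real M * sin t)) (n - int (Suc k) * (int M)\<^sup>2))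
          \<le> CB * (1 + real (Suc k) * real M) ^ (2 * a + 1)" by simp
      qed (use q M CB(1) in auto)
      show "summable (\<lambda>k. ?B k / (1 + D / 2) ^ Suc k)"
        using summable_mult[OF sumG[of a], of ?c] by (simp add: R_def mult_ac)
    qed
    also have "(\<Sum>k. ?B k / (1 + D / 2) ^ Suc k) = ?c * G a"
      using suminf_mult[OF sumG[of a], of ?c] by (simp add: R_def G_def mult_ac)
    also have "(1 + D) ^ L * (?c * G a) \<le> (3/2) ^ h * (?c * G a)"
      using DL CB(1) G0 q M by (intro mult_right_mono) auto
    finally have "q ^ a * norm (fc (\<lambda>t. S t * (mw D (phase M \<theta> t) ^ L - 1)) n) \<le> q ^ a * ((3/2) ^ h * (?c * G a))"
      using q by (intro mult_left_mono) auto
    also have "\<dots> = CB * 2 ^ (2 * a + 1) * G a * ((3/2) ^ h / 16 ^ h)"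
      using q by (simp add: M_def)
    also have "\<dots> \<le> CB * 2 ^ (2 * a + 1) * G a * (3/4) ^ h"
    proof (intro mult_left_mono)
      have "(3/2 :: real) ^ h / 16 ^ h = (3/32) ^ h" by (simp add: power_divide[symmetric])
      also have "\<dots> \<le> (3/4) ^ h" by (intro power_mono) auto
      finally show "(3/2 :: real) ^ h / 16 ^ h \<le> (3/4) ^ h" .
    qed (use CB(1) G0 in auto)
    finally have 1: "q ^ a * norm (fc (\<lambda>t. S t * (mw D (phase M \<theta> t) ^ L - 1)) n) \<le> CB * 2 ^ (2 * a + 1) * G a * (3/4) ^ h" .
    have "q ^ a * norm (fc (\<lambda>t. S t * (mw D (phase M \<theta> t) ^ L * cutoff D (phase M \<theta> t))) n) \<le> CC * ((1 + real L) * (real M)\<^sup>2) ^ a * (1/2) ^ L"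
      unfolding q_def by (rule CC(2)[OF M])
    also have "\<dots> \<le> CC * ((real \<Lambda> * 2 ^ h) * (2 ^ h) ^ 8) ^ a * (1/2) ^ L"
    proof -
      have "1 + real L \<le> real \<Lambda> * (1 + real h)" using \<Lambda> by (simp add: L_def algebra_simps)
      also have "\<dots> \<le> real \<Lambda> * 2 ^ h"
      proof (rule mult_left_mono)
        have "real (Suc h) \<le> real (2 ^ h)" unfolding of_nat_le_iff using less_exp[of h] by (rule Suc_leI)
        then show "1 + real h \<le> 2 ^ h" by simp
      qed simp
      finally have "(1 + real L) * (real M)\<^sup>2 \<le> (real \<Lambda> * 2 ^ h) * (2 ^ h) ^ 8"
        by (intro mult_mono) (auto simp: M4 power_mult[symmetric])
      then show ?thesis using CC(1) by (intro mult_right_mono mult_left_mono power_mono) auto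
    qed
    also have "\<dots> = CC * real \<Lambda> ^ a * ((2 ^ h) ^ (9 * a) * (1/2) ^ L)"
      unfolding power_mult_distrib power_mult[symmetric] by (simp add: power_add[symmetric] algebra_simps)
    also have "\<dots> \<le> CC * real \<Lambda> ^ a * (3/4) ^ h"
    proof (intro mult_left_mono)
      \<comment> \<open>Of the exponent \<open>(12 a + 1) h\<close> the part \<open>9 a h\<close>
        pays for the derivatives; \<open>(3 a + 1) h\<close>, which is at least \<open>h\<close>, is
        left over.\<close>
      have "(2 ^ h) ^ (9 * a) * (1/2 :: real) ^ L = 2 ^ (9 * a * h) * (1/2) ^ (9 * a * h + (3 * a + 1) * h)"
        by (simp add: L_def \<Lambda>_def power_mult[symmetric] algebra_simps)
      also have "\<dots> = (1/2) ^ ((3 * a + 1) * h)"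
        unfolding power_add[of "1/2 :: real" "9 * a * h"] mult.assoc[symmetric] power_mult_distrib[symmetric] by simp
      also have "\<dots> \<le> (1/2) ^ h" by (intro power_decreasing) auto
      also have "\<dots> \<le> (3/4) ^ h" by (intro power_mono) auto
      finally show "(2 ^ h) ^ (9 * a) * (1/2 :: real) ^ L \<le> (3/4) ^ h" .
    qed (use CC(1) in auto)
    finally have 2: "q ^ a * norm (fc (\<lambda>t. S t * (mw D (phase M \<theta> t) ^ L * cutoff D (phase M \<theta> t))) n) \<le> CC * real \<Lambda> ^ a * (3/4) ^ h" .
    have "fc (\<lambda>t. damp D L M \<theta> S t - S t) n = fc (\<lambda>t. S t * (mw D (phase M \<theta> t) ^ L - 1)) n
      - fc (\<lambda>t. S t * (mw D (phase M \<theta> t) ^ L * cutoff D (phase M \<theta> t))) n"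
      using split[of "\<lambda>_. 1" \<theta> n] by simp
    then have "norm (fc (\<lambda>t. damp D L M \<theta> S t - S t) n) \<le> norm (fc (\<lambda>t. S t * (mw D (phase M \<theta> t) ^ L - 1)) n)
      + norm (fc (\<lambda>t. S t * (mw D (phase M \<theta> t) ^ L * cutoff D (phase M \<theta> t))) n)"
      by (simp only: norm_triangle_ineq4)
    then have "q ^ a * norm (fc (\<lambda>t. damp D L M \<theta> S t - S t) n) \<le> q ^ a * (norm (fc (\<lambda>t. S t * (mw D (phase M \<theta> t) ^ L - 1)) n)
      + norm (fc (\<lambda>t. S t * (mw D (phase M \<theta> t) ^ L * cutoff D (phase M \<theta> t))) n))"
      using q by (intro mult_left_mono) auto
    also have "\<dots> \<le> E2 * (3/4) ^ h" using add_mono[OF 1 2] by (simp add: E2_def algebra_simps)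
    also have "\<dots> \<le> (E1 + E2) * (3/4) ^ h" using E by (intro mult_right_mono) auto
    finally show "\<bar>of_int n\<bar> ^ a * norm (fc (\<lambda>t. damp D L M \<theta> S t - S t) n) \<le> \<epsilon>"
      using h by (simp add: q_def)
  qed
qed

section \<open>Choice of the shift and shrinking of the support\<close>

lemma cos_ge_quadratic: "cos y \<ge> 1 - y\<^sup>2 / 2" for y :: real
proof -
  have "(sin (y / 2))\<^sup>2 \<le> (y / 2)\<^sup>2" using abs_sin_x_le_abs_x[of "y / 2"] by (simp only: abs_le_square_iff)
  then show ?thesis using cos_double_sin[of "y / 2"] by (simp add: power_divide)
qed

text \<open>The shifts are spaced by \<open>2 pi / P\<close> around the circle, so one of them
  brings \<open>s\<close> within that distance of a multiple of 2 pi; \<open>y\<close> is the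
  remainder of \<open>s\<close> modulo the spacing.\<close>

lemma ex_shift_cos:
  fixes P :: nat
  assumes P: "P > 0"
  obtains i where "i < P" "cos (s + 2 * pi * real i / real P) \<ge> 1 - (2 * pi / real P)\<^sup>2 / 2"
proof -
  define j where "j = \<lfloor>s * real P / (2 * pi)\<rfloor>"
  define y where "y = s - 2 * pi * of_int j / real P"
  have "of_int j \<le> s * real P / (2 * pi)" "s * real P / (2 * pi) < of_int j + 1"
    unfolding j_def by linarith+
  then have "of_int j * (2 * pi) \<le> s * real P" "s * real P < (of_int j + 1) * (2 * pi)"
    by (simp_all add: pos_le_divide_eq pos_divide_less_eq)
  then have *: "0 \<le> s * real P - 2 * pi * of_int j" "s * real P - 2 * pi * of_int j \<le> 2 * pi"
    by (simp_all add: algebra_simps)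
  have "y = (s * real P - 2 * pi * of_int j) / real P" using P by (simp add: y_def field_simps)
  then have y: "0 \<le> y" "y \<le> 2 * pi / real P"
    using * P by (simp_all add: divide_right_mono)
  \<comment> \<open>Undoing \<open>j\<close> spacings asks for the index \<open>- j\<close>;
    reduction modulo \<open>P\<close> brings it below \<open>P\<close> and changes the angle by
    whole turns only.\<close>
  define i where "i = nat ((- j) mod int P)"
  have i: "i < P" "int i = (- j) mod int P" using P by (auto simp: i_def nat_less_iff)
  obtain m where m: "j + int i = int P * m"
  proof -
    have "(j + int i) mod int P = 0" unfolding i(2) by (simp add: mod_simps)
    then show ?thesis using that by (metis mod_0_imp_dvd dvdE)
  qed
  have "s + 2 * pi * real i / real P = y + 2 * pi * of_int (j + int i) / real P"
    using P by (simp add: y_def field_simps)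
  also have "\<dots> = y + 2 * pi * of_int m" unfolding m using P by simp
  finally have "cos (s + 2 * pi * real i / real P) = cos y"
    using cos_int_2pin sin_int_2pin by (simp add: cos_add)
  also have "\<dots> \<ge> 1 - y\<^sup>2 / 2" by (rule cos_ge_quadratic)
  finally have "cos (s + 2 * pi * real i / real P) \<ge> 1 - y\<^sup>2 / 2" .
  moreover have "y\<^sup>2 \<le> (2 * pi / real P)\<^sup>2" using y by (intro power_mono) auto
  ultimately show ?thesis using that[OF i(1)] by linarith
qed

text \<open>The \<open>P\<close> equally spaced shifts cover \<open>A\<close>, so one of them captures the proportion \<open>1 / P\<close>.\<close>

lemma ex_shift_measure:
  fixes P :: nat and g :: "real \<Rightarrow> real"
  assumes P: "P > 0" and A: "A \<in> lmeasurable" and g: "continuous_on UNIV g"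
    and c: "c < 1 - (2 * pi / real P)\<^sup>2 / 2"
  obtains \<theta> where "measure lebesgue (A \<inter> {t. c < cos (g t + \<theta>)}) \<ge> measure lebesgue A / real P"
proof -
  define E where "E i = A \<inter> {t. c < cos (g t + 2 * pi * real i / real P)}" for i
  have op: "open {t. c < cos (g t + \<theta>)}" for \<theta>
    by (intro open_Collect_less continuous_intros g)
  have E: "E i \<in> lmeasurable" for i
    unfolding E_def using A op[THEN borel_open] by (intro fmeasurable_Int_fmeasurable) auto
  have "A \<subseteq> (\<Union>i<P. E i)"
  proof
    fix t assume t: "t \<in> A"
    obtain i where "i < P" "cos (g t + 2 * pi * real i / real P) \<ge> 1 - (2 * pi / real P)\<^sup>2 / 2"
      using ex_shift_cos[OF P] by blast
    then show "t \<in> (\<Union>i<P. E i)" using t c by (force simp: E_def)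
  qed
  then have "A = (\<Union>i<P. E i)" by (auto simp: E_def)
  then have le: "measure lebesgue A \<le> (\<Sum>i<P. measure lebesgue (E i))"
    using E by (metis finite_lessThan measure_UNION_le fmeasurableD)
  have "\<not> (\<forall>i<P. measure lebesgue (E i) < measure lebesgue A / real P)"
  proof
    assume "\<forall>i<P. measure lebesgue (E i) < measure lebesgue A / real P"
    then have "(\<Sum>i<P. measure lebesgue (E i)) < (\<Sum>i<P. measure lebesgue A / real P)"
      using P by (intro sum_strict_mono) auto
    also have "\<dots> = measure lebesgue A" using P by simp
    finally show False using le by linarith
  qed
  then obtain i where "measure lebesgue (E i) \<ge> measure lebesgue A / real P" by (auto simp: not_less)
  then show ?thesis using that[of "2 * pi * real i / real P"] by (simp add: E_def)
qed

text \<open>The measure of the closed support within one period. The interior is taken because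
  localisation needs zeros on a whole neighbourhood.\<close>

definition support_measure :: "(real \<Rightarrow> complex) \<Rightarrow> real" where
  "support_measure S = measure lebesgue ({0..2 * pi} - interior {t. S t = 0})"

lemma lmeasurable_support: "{0..2 * pi} - interior {t. S t = 0} \<in> lmeasurable"
  by (intro fmeasurable_Diff) (auto intro: borel_open)

text \<open>The coefficient bounds fix \<open>L\<close> and \<open>M\<close> first; averaging over
  shifts then selects a \<open>\<theta>\<close> for which the new zeros catch their share of the old
  support.\<close>

lemma damping_step:
  assumes S: "psmooth S" and \<epsilon>: "\<epsilon> > 0"
  obtains S' where "psmooth S'" "\<And>t. S t = 0 \<Longrightarrow> S' t = 0"
    "\<And>l K n. C1_le l K \<Longrightarrow> norm (fc (\<lambda>t. (S' t - S t) * l t) n) \<le> \<epsilon> * K"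
    "\<And>n. n < 0 \<Longrightarrow> \<bar>of_int n\<bar> ^ a * norm (fc (\<lambda>t. S' t - S t) n) \<le> \<epsilon>"
    "support_measure S' \<le> (1 - 1 / (80 * real (12 * a + 1))) * support_measure S"
proof -
  define D where "D = 1 / (4 * real (12 * a + 1))"
  \<comment> \<open>\<open>P\<close> equals \<open>20 / D\<close>: the spacing
    \<open>2 pi / P\<close> is then below 0.32 \<open>D\<close>, and half its square is below
    \<open>D^2 / 16\<close>, the threshold at which the cutoff equals 1.\<close>
  define P where "P = 80 * (12 * a + 1)"
  have D: "0 < D" "D \<le> 1/4" by (auto simp: D_def field_simps)
  have P: "P > 0" by (simp add: P_def)
  obtain L M where LM: "M \<ge> 1"
    "\<And>\<theta> l K n. C1_le l K \<Longrightarrow> norm (fc (\<lambda>t. (damp D L M \<theta> S t - S t) * l t) n) \<le> \<epsilon> * K"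
    "\<And>\<theta> n. n < 0 \<Longrightarrow> \<bar>of_int n\<bar> ^ a * norm (fc (\<lambda>t. damp D L M \<theta> S t - S t) n) \<le> \<epsilon>"
    by (rule damp_coefficients[OF S \<epsilon> D_def]) blast
  let ?A = "{0..2 * pi} - interior {t. S t = 0}"
  have c: "1 - D\<^sup>2 / 16 < 1 - (2 * pi / real P)\<^sup>2 / 2"
  proof -
    have PD: "real P = 20 / D" by (simp add: P_def D_def)
    have "2 * pi / real P = D * (pi / 10)" by (simp add: PD)
    also have "\<dots> < D * (32 / 100)" using D pi_approx by (intro mult_strict_left_mono) auto
    finally have "(2 * pi / real P)\<^sup>2 < (D * (32 / 100))\<^sup>2" using P by (intro power_strict_mono) auto
    also have "\<dots> < D\<^sup>2 / 8" using D by (simp add: power2_eq_square)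
    finally show ?thesis by simp
  qed
  obtain \<theta> where \<theta>: "measure lebesgue (?A \<inter> {t. 1 - D\<^sup>2 / 16 < cos (phase M 0 t + \<theta>)}) \<ge> measure lebesgue ?A / real P"
    using ex_shift_measure[OF P lmeasurable_support[of S] smooth_imp_continuous[OF smooth_phase[of M 0]] c] by blast
  let ?U = "{t. 1 - D\<^sup>2 / 16 < cos (phase M 0 t + \<theta>)}"
  let ?S = "damp D L M \<theta> S"
  have "psmooth ?S"
    unfolding damp_def [abs_def]
    by (intro psmooth_mult S psmooth_power psmooth_diff psmooth_const psmooth_compose_phase psmooth_mw[OF D] psmooth_cutoff)
  moreover have S0: "?S t = 0" if "S t = 0" for t using that by (simp add: damp_def)
  moreover have "support_measure ?S \<le> (1 - 1 / real P) * support_measure S"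
  proof -
    have op: "open ?U" by (intro open_Collect_less continuous_intros smooth_imp_continuous[OF smooth_phase])
    \<comment> \<open>There the cutoff is 1, so the damped function vanishes; the set is open, hence
      consists of interior zeros.\<close>
    have "?U \<subseteq> interior {t. ?S t = 0}"
    proof (rule interior_maximal[OF _ op])
      have "phase M 0 t + \<theta> = phase M \<theta> t" for t by (simp add: phase_def)
      then show "?U \<subseteq> {t. ?S t = 0}" using cutoff_eq_1[OF D(1)] by (auto simp: damp_def)
    qed
    moreover have "interior {t. S t = 0} \<subseteq> interior {t. ?S t = 0}"
      using S0 by (intro interior_mono) auto
    ultimately have sub: "{0..2 * pi} - interior {t. ?S t = 0} \<subseteq> ?A - (?A \<inter> ?U)" by blast
    have U: "?A \<inter> ?U \<in> lmeasurable"
      using lmeasurable_support[of S] op[THEN borel_open] by (intro fmeasurable_Int_fmeasurable) auto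
    have "support_measure ?S \<le> measure lebesgue (?A - (?A \<inter> ?U))"
      unfolding support_measure_def
      by (intro measure_mono_fmeasurable[OF sub] fmeasurable.Diff lmeasurable_support U fmeasurableD)
    also have "\<dots> = measure lebesgue ?A - measure lebesgue (?A \<inter> ?U)"
      using lmeasurable_support[of S] U by (intro measurable_measure_Diff) (auto dest: fmeasurableD)
    also have "\<dots> \<le> (1 - 1 / real P) * support_measure S"
      using \<theta> by (simp add: support_measure_def algebra_simps)
    finally show ?thesis .
  qed
  ultimately show ?thesis using that[of ?S] LM(2,3) by (simp add: P_def)
qed

section \<open>Localisation\<close>

lemma norm_diff_geometric:
  fixes x :: "nat \<Rightarrow> complex"
  assumes "\<And>j. j \<ge> j0 \<Longrightarrow> norm (x (Suc j) - x j) \<le> K * (1/2) ^ j"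
  shows "j \<ge> j0 \<Longrightarrow> norm (x (j + m) - x j) \<le> 2 * K * (1/2) ^ j"
proof -
  assume j: "j \<ge> j0"
  have K: "K \<ge> 0"
  proof -
    have "0 \<le> norm (x (Suc j0) - x j0)" by simp
    also have "\<dots> \<le> K * (1/2) ^ j0" using assms by simp
    finally have *: "0 \<le> K * (1/2) ^ j0" .
    show ?thesis
    proof (rule ccontr)
      assume "\<not> 0 \<le> K"
      then have "K * (1/2) ^ j0 < 0" by (intro mult_neg_pos) auto
      with * show False by linarith
    qed
  qed
  \<comment> \<open>The remaining geometric tail is subtracted to make the induction on
    \<open>m\<close> close.\<close>
  have "norm (x (j + m) - x j) \<le> 2 * K * (1/2) ^ j - 2 * K * (1/2) ^ (j + m)"
  proof (induction m)
    case (Suc m)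
    have "norm (x (j + Suc m) - x j) \<le> norm (x (Suc (j + m)) - x (j + m)) + norm (x (j + m) - x j)"
      using norm_triangle_ineq[of "x (Suc (j + m)) - x (j + m)" "x (j + m) - x j"] by simp
    also have "\<dots> \<le> K * (1/2) ^ (j + m) + (2 * K * (1/2) ^ j - 2 * K * (1/2) ^ (j + m))"
      using assms[of "j + m"] j Suc by (intro add_mono) auto
    finally show ?case by simp
  qed simp
  moreover have "0 \<le> 2 * K * (1/2) ^ (j + m)" using K by simp
  ultimately show ?thesis by linarith
qed

lemma convergent_geometric:
  fixes x :: "nat \<Rightarrow> complex"
  assumes "\<And>j. norm (x (Suc j) - x j) \<le> K * (1/2) ^ j"
  shows "convergent x"
proof -
  have "summable (\<lambda>j. K * (1/2 :: real) ^ j)" by (intro summable_mult summable_geometric) auto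
  then have "summable (\<lambda>j. x (Suc j) - x j)"
    by (rule summable_comparison_test') (use assms in auto)
  then have "convergent (\<lambda>n. (\<Sum>j<n. x (Suc j) - x j) + x 0)"
    by (intro convergent_add convergent_const) (simp add: summable_iff_convergent)
  then show ?thesis by (simp add: sum_lessThan_telescope)
qed

text \<open>This serves to lift a denominator away from 0 with one continuous derivative, leaving it
  untouched where it is already large.\<close>

lemma Ck_pos_part_square: "Ck (Suc 0) (\<lambda>x::real. (max 0 x)\<^sup>2)"
proof (rule Ck_SucI)
  show "\<forall>x::real. ((\<lambda>x. (max 0 x)\<^sup>2) has_vector_derivative 2 * max 0 x) (at x)"
  proof
    fix x :: real
    consider "x > 0" | "x < 0" | "x = 0" by linarith
    then show "((\<lambda>x. (max 0 x)\<^sup>2) has_vector_derivative 2 * max 0 x) (at x)"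
    proof cases
      case 1
      have "((\<lambda>x. x\<^sup>2) has_real_derivative 2 * x) (at x)" by (auto intro!: derivative_eq_intros)
      then have "((\<lambda>x. x\<^sup>2) has_vector_derivative 2 * max 0 x) (at x)"
        using 1 by (simp add: has_real_derivative_iff_has_vector_derivative)
      then show ?thesis
        by (rule has_vector_derivative_transform_within_open[of _ _ _ "{0<..}"]) (use 1 in auto)
    next
      case 2
      have "((\<lambda>x. 0) has_vector_derivative 2 * max 0 x) (at x)" using 2 by simp
      then show ?thesis
        by (rule has_vector_derivative_transform_within_open[of _ _ _ "{..<0}"]) (use 2 in auto)
    next
      case 3
      have lim: "((\<lambda>y. \<bar>y\<bar>) \<longlongrightarrow> (0::real)) (at 0)" by (rule tendsto_rabs_zero[OF tendsto_ident_at])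
      have "\<forall>\<^sub>F y::real in at 0. norm (((max 0 y)\<^sup>2 - (max 0 0)\<^sup>2) / (y - 0)) \<le> \<bar>y\<bar>"
        by (intro always_eventually) (auto simp: power2_eq_square max_def)
      from Lim_null_comparison[OF this lim]
      have "((\<lambda>y. ((max 0 y)\<^sup>2 - (max 0 0)\<^sup>2) / (y - 0)) \<longlongrightarrow> (0::real)) (at 0)" .
      then have "((\<lambda>x. (max 0 x)\<^sup>2) has_real_derivative 0) (at (0::real))"
        by (simp add: has_field_derivative_iff)
      then show ?thesis using 3 by (simp add: has_real_derivative_iff_has_vector_derivative)
    qed
  qed
  show "Ck 0 (\<lambda>x::real. 2 * max 0 x)" by (auto intro!: continuous_intros)
qed

lemma one_minus_cis_mult: "(1 - cis x) * (1 - cis (- x)) = of_real (2 - 2 * cos x)"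
  by (simp add: complex_eq_iff algebra_simps)

text \<open>The inverse of \<open>1 - cis s\<close> is \<open>1 - cis (- s)\<close> divided by the
  squared modulus \<open>2 - 2 cos s\<close>. Adding the squared positive part of \<open>y0\<close>
  minus this modulus keeps the denominator positive everywhere and alters it only below
  \<open>y0\<close>.\<close>

lemma ex_local_inverse:
  assumes y0: "y0 > 0"
  obtains l K where "K > 0" "C1_le l K" "\<And>t. y0 \<le> 2 - 2 * cos (t - t0) \<Longrightarrow> l t * (1 - cis (t - t0)) = 1"
proof -
  define Y where "Y t = 2 - 2 * cos (t - t0)" for t
  define d where "d t = Y t + (max 0 (y0 - Y t))\<^sup>2" for t
  define l where "l t = (1 - cis (- (t - t0))) * inverse (complex_of_real (d t))" for t
  have Y0: "Y t \<ge> 0" for t by (simp add: Y_def)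
  have d0: "d t > 0" for t
  proof (cases "Y t = 0")
    case False
    then show ?thesis using Y0[of t] zero_le_power2[of "max 0 (y0 - Y t)"] unfolding d_def by linarith
  qed (use y0 in \<open>simp add: d_def\<close>)
  have sY: "smooth Y" unfolding Y_def [abs_def] by (intro smooth_intros)
  have "smooth (\<lambda>t. y0 - Y t)" by (intro smooth_intros sY)
  then have "Ck (Suc 0) (\<lambda>t. (max 0 (y0 - Y t))\<^sup>2)"
    unfolding smooth_def by (intro Ck_compose[OF Ck_pos_part_square]) blast
  then have "Ck (Suc 0) d"
    unfolding d_def [abs_def] using sY unfolding smooth_def by (intro Ck_add) blast+
  then have "Ck (Suc 0) (\<lambda>t. inverse (complex_of_real (d t)))"
    using d0 by (intro Ck_inverse Ck_linear[OF bounded_linear_of_real]) (auto simp: less_imp_neq[symmetric] simp del: Ck.simps)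
  moreover have "smooth (\<lambda>t. 1 - cis (- (t - t0)))" by (intro smooth_intros)
  ultimately have "Ck (Suc 0) l"
    unfolding l_def [abs_def] smooth_def by (intro Ck_mult) blast+
  moreover have "periodic l"
  proof -
    have "t + 2 * pi - t0 = (t - t0) + 2 * pi" "- (t - t0 + 2 * pi) = - (t - t0) - 2 * pi" for t by simp_all
    then have "cos (t + 2 * pi - t0) = cos (t - t0)" "cis (- (t + 2 * pi - t0)) = cis (- (t - t0))" for t
      by (simp_all only: cos_periodic cis_divide[symmetric] cis_2pi div_by_1)
    then show ?thesis by (simp only: periodic_def l_def d_def Y_def simp_thms)
  qed
  ultimately obtain K where K: "K > 0" "C1_le l K" by (rule Ck_imp_C1_le)
  have "l t * (1 - cis (t - t0)) = 1" if "y0 \<le> 2 - 2 * cos (t - t0)" for t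
  proof -
    have "d t = Y t" using that by (simp add: d_def Y_def max_def)
    moreover have "(1 - cis (t - t0)) * (1 - cis (- (t - t0))) = of_real (Y t)"
      unfolding Y_def by (rule one_minus_cis_mult)
    moreover have "complex_of_real (d t) \<noteq> 0" using d0[of t] by simp
    moreover have "l t * (1 - cis (t - t0)) = ((1 - cis (t - t0)) * (1 - cis (- (t - t0)))) * inverse (complex_of_real (d t))"
      unfolding l_def by (simp only: mult_ac)
    ultimately show ?thesis by (metis right_inverse)
  qed
  then show ?thesis using that K by blast
qed

lemma cos_gt_imp_near:
  assumes "cos s > cos d" "0 < d" "d < pi"
  obtains k :: int where "\<bar>s - 2 * pi * of_int k\<bar> < d"
proof -
  obtain k :: int where k: "(s + pi) - 2 * pi * of_int k \<in> {0..2 * pi}" by (rule ex_shift_into_period)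
  define r where "r = s - 2 * pi * of_int k"
  have r: "\<bar>r\<bar> \<le> pi" using k by (auto simp: r_def)
  have "cos r = cos s" unfolding r_def using cos_int_2pin sin_int_2pin by (simp add: cos_diff)
  then have "cos \<bar>r\<bar> > cos d" using assms by simp
  then have "\<bar>r\<bar> < d" using cos_monotone_0_pi_le[of d "\<bar>r\<bar>"] assms r by (cases "\<bar>r\<bar> < d") auto
  then show ?thesis using that by (simp add: r_def)
qed

lemma sum_symmetric_telescope:
  fixes a :: "int \<Rightarrow> complex"
  shows "(\<Sum>n\<in>{-int N..int N}. a n - a (n - 1)) = a (int N) - a (- int N - 1)"
proof (induction N)
  case (Suc N)
  have "{-int (Suc N)..int (Suc N)} = insert (int N + 1) (insert (- int N - 1) {-int N..int N})" by auto
  then show ?case using Suc by (simp add: algebra_simps)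
qed simp

text \<open>The partial sums of each \<open>S j\<close> telescope to two coefficients of the
  quotient by \<open>1 - cis (t - t0)\<close>. As \<open>c\<close> is only a pointwise limit of
  coefficients, these must be small uniformly in \<open>j\<close>: the increments of the quotients'
  coefficients are summable uniformly in \<open>n\<close>, by the hypothesis with multiplier
  \<open>l\<close>, and each single quotient has coefficients of order 1/|n|.\<close>

lemma local_convergence:
  assumes S: "\<And>j. psmooth (S j)" "\<And>j t. S j t = 0 \<Longrightarrow> S (Suc j) t = 0"
    and \<Delta>: "\<And>j l K n. C1_le l K \<Longrightarrow> norm (fc (\<lambda>t. (S (Suc j) t - S j t) * l t) n) \<le> (1/2) ^ j * K"
    and c: "\<And>n. (\<lambda>j. fc (S j) n) \<longlonglongrightarrow> c n"
    and t0: "t0 \<in> interior {t. S j0 t = 0}"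
  shows "(\<lambda>N. \<Sum>n\<in>{-int N..int N}. c n * cis (of_int n * t0)) \<longlonglongrightarrow> 0"
proof -
  obtain d0 where d0: "d0 > 0" "ball t0 d0 \<subseteq> {t. S j0 t = 0}" using t0 by (auto simp: mem_interior)
  define d where "d = min d0 1"
  have d: "0 < d" "d < pi" "d \<le> d0" using d0 pi_gt3 by (auto simp: d_def)
  have "cos d < 1" using cos_monotone_0_pi[of 0 d] d by simp
  then have y0: "2 - 2 * cos d > 0" by simp
  obtain l K where l: "K > 0" "C1_le l K" "\<And>t. 2 - 2 * cos d \<le> 2 - 2 * cos (t - t0) \<Longrightarrow> l t * (1 - cis (t - t0)) = 1"
    by (rule ex_local_inverse[OF y0]) blast
  have zero: "S j t = 0" if "j \<ge> j0" "S j0 t = 0" for j t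
    using that by (induction rule: dec_induct) (auto intro: S(2))
  \<comment> \<open>\<open>l\<close> inverts the factor except close to the translates of
    \<open>t0\<close> by multiples of 2 pi, and there \<open>S j\<close> vanishes for
    \<open>j \<ge> j0\<close>.\<close>
  have fac: "S j t = S j t * l t * (1 - cis (t - t0))" if j: "j \<ge> j0" for j t
  proof (cases "2 - 2 * cos d \<le> 2 - 2 * cos (t - t0)")
    case True
    then show ?thesis using l(3) by (simp add: mult.assoc)
  next
    case False
    then obtain k :: int where k: "\<bar>t - t0 - 2 * pi * of_int k\<bar> < d"
      using cos_gt_imp_near[of d "t - t0"] d by auto
    then have "t - 2 * pi * of_int k \<in> ball t0 d0" using d by (auto simp: dist_real_def abs_if split: if_splits)
    then have "S j0 (t - 2 * pi * of_int k) = 0" using d0 by auto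
    moreover have "S j0 t = S j0 (t - 2 * pi * of_int k)"
      using periodic_int[of "S j0" "t - 2 * pi * of_int k" k] S(1) by (simp add: psmooth_def)
    ultimately show ?thesis using zero[OF j] by simp
  qed
  have cS: "continuous_on UNIV (S j)" for j using S(1) smooth_imp_continuous by (auto simp: psmooth_def)
  have cl: "continuous_on UNIV l" by (rule C1_le_continuous[OF l(2)])
  define g where "g j n = fc (\<lambda>t. S j t * l t) n" for j n
  \<comment> \<open>Multiplication by \<open>cis t\<close> shifts frequencies by one, so the
    factorisation becomes a first-order difference relation, which telescopes after twisting by
    \<open>cis (n t0)\<close>.\<close>
  have coef: "fc (S j) n = g j n - cis (- t0) * g j (n - 1)" if "j \<ge> j0" for j n
  proof -
    have "S j = (\<lambda>t. S j t * l t - cis (- t0) * (cis (of_int 1 * t) * (S j t * l t)))"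
    proof
      fix t
      have "cis (t - t0) = cis (- t0) * cis (of_int 1 * t)" by (simp add: cis_mult)
      then show "S j t = S j t * l t - cis (- t0) * (cis (of_int 1 * t) * (S j t * l t))"
        by (subst fac[OF that]) (simp add: algebra_simps)
    qed
    then have "fc (S j) n = fc (\<lambda>t. S j t * l t - cis (- t0) * (cis (of_int 1 * t) * (S j t * l t))) n" by simp
    also have "\<dots> = g j n - fc (\<lambda>t. cis (- t0) * (cis (of_int 1 * t) * (S j t * l t))) n"
      unfolding g_def by (rule fc_diff) (intro continuous_intros cS cl)+
    finally show ?thesis unfolding fc_cmult fc_cis g_def .
  qed
  have part: "norm (\<Sum>n\<in>{-int N..int N}. fc (S j) n * cis (of_int n * t0)) \<le> norm (g j (int N)) + norm (g j (- int N - 1))"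
    if "j \<ge> j0" for j N
  proof -
    have "fc (S j) n * cis (of_int n * t0) = g j n * cis (of_int n * t0) - g j (n - 1) * cis (of_int (n - 1) * t0)" for n
    proof -
      have "cis (of_int (n - 1) * t0) = cis (- t0) * cis (of_int n * t0)" by (simp add: cis_mult algebra_simps)
      then show ?thesis unfolding coef[OF that] by (simp add: algebra_simps)
    qed
    then have "(\<Sum>n\<in>{-int N..int N}. fc (S j) n * cis (of_int n * t0)) = g j (int N) * cis (of_int (int N) * t0) - g j (- int N - 1) * cis (of_int (- int N - 1) * t0)"
      using sum_symmetric_telescope[of "\<lambda>n. g j n * cis (of_int n * t0)" N] by simp
    then show ?thesis using norm_triangle_ineq4[of "g j (int N) * cis (of_int (int N) * t0)" "g j (- int N - 1) * cis (of_int (- int N - 1) * t0)"]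
      by (simp add: norm_mult)
  qed
  have g_step: "norm (g (Suc j) n - g j n) \<le> K * (1/2) ^ j" for j n
  proof -
    have "g (Suc j) n - g j n = fc (\<lambda>t. (S (Suc j) t - S j t) * l t) n"
      unfolding g_def by (subst fc_diff[symmetric]) (auto intro!: continuous_intros cS cl simp: algebra_simps)
    then show ?thesis using \<Delta>[OF l(2), of j n] by (simp add: mult.commute)
  qed
  have g_decay: "\<exists>C. \<forall>n. \<bar>of_int n\<bar> * norm (g j n) \<le> C" for j
  proof -
    obtain Kj where "Kj > 0" "C1_le (S j) Kj" by (rule psmooth_C1_le[OF S(1)])
    then have p: "C1_le (\<lambda>t. S j t * l t) (2 * Kj * K)" using C1_le_mult l(2) by blast
    then obtain f' where f': "\<forall>t. ((\<lambda>t. S j t * l t) has_vector_derivative f' t) (at t)" "continuous_on UNIV f'" "\<forall>t. norm (f' t) \<le> 2 * Kj * K"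
      unfolding C1_le_def by blast
    have "fc f' n = \<i> * of_int n * g j n" for n
      unfolding g_def using p f' by (intro fc_deriv) (auto simp: C1_le_def)
    then have "\<bar>of_int n\<bar> * norm (g j n) = norm (fc f' n)" for n by (simp add: norm_mult)
    then have "\<bar>of_int n\<bar> * norm (g j n) \<le> 2 * pi * (2 * Kj * K)" for n
      using fc_norm_le[OF f'(2), of "2 * Kj * K" n] f'(3) by presburger
    then show ?thesis by blast
  qed
  show ?thesis
  proof (rule LIMSEQ_I)
    fix \<epsilon> :: real
    assume \<epsilon>: "\<epsilon> > 0"
    have "(\<lambda>j. 2 * K * (1/2 :: real) ^ j) \<longlonglongrightarrow> 2 * K * 0"
      by (intro tendsto_intros LIMSEQ_realpow_zero) auto
    then have "\<forall>\<^sub>F j in sequentially. 2 * K * (1/2 :: real) ^ j < \<epsilon> / 8"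
      by (rule order_tendstoD(2)) (use \<epsilon> in simp)
    then obtain j1 where j1: "\<And>j. j \<ge> j1 \<Longrightarrow> 2 * K * (1/2 :: real) ^ j < \<epsilon> / 8"
      unfolding eventually_sequentially by blast
    define j where "j = max j0 j1"
    have j: "j \<ge> j0" "2 * K * (1/2) ^ j < \<epsilon> / 8" using j1 by (auto simp: j_def)
    obtain C where C: "\<And>n. \<bar>of_int n\<bar> * norm (g j n) \<le> C" using g_decay by blast
    define N0 where "N0 = nat \<lceil>8 * \<bar>C\<bar> / \<epsilon>\<rceil> + 1"
    have small: "norm (g j n) \<le> \<epsilon> / 8" if "\<bar>n\<bar> \<ge> int N0" for n
    proof -
      have "8 * \<bar>C\<bar> / \<epsilon> \<le> real N0" unfolding N0_def by linarith
      also have "\<dots> \<le> \<bar>of_int n\<bar>" using that by linarith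
      finally have "8 * \<bar>C\<bar> \<le> \<bar>of_int n\<bar> * \<epsilon>" using \<epsilon> by (simp add: pos_divide_le_eq)
      then have "\<bar>of_int n\<bar> * norm (g j n) \<le> \<bar>of_int n\<bar> * (\<epsilon> / 8)" using C[of n] by simp
      moreover have "N0 \<ge> 1" by (simp add: N0_def)
      then have "\<bar>real_of_int n\<bar> > 0" using that by linarith
      ultimately show ?thesis by (simp only: mult_le_cancel_left_pos)
    qed
    \<comment> \<open>At most \<open>\<epsilon> / 8\<close> comes from all increments after stage
      \<open>j\<close> and at most \<open>\<epsilon> / 8\<close> from the decay of the single
      function at stage \<open>j\<close>; hence \<open>N0\<close> does not depend on
      \<open>i\<close>.\<close>
    have gi: "norm (g i n) \<le> \<epsilon> / 4" if "i \<ge> j" "\<bar>n\<bar> \<ge> int N0" for i n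
    proof -
      obtain m where "i = j + m" using \<open>i \<ge> j\<close> le_Suc_ex by blast
      then have "norm (g i n - g j n) \<le> 2 * K * (1/2) ^ j"
        using norm_diff_geometric[of 0 "\<lambda>j. g j n" K j m] g_step by simp
      then show ?thesis using norm_triangle_ineq[of "g i n - g j n" "g j n"] j small[OF that(2)] by simp
    qed
    show "\<exists>no. \<forall>N\<ge>no. norm ((\<Sum>n\<in>{-int N..int N}. c n * cis (of_int n * t0)) - 0) < \<epsilon>"
    proof (intro exI[of _ N0] allI impI)
      fix N assume N: "N \<ge> N0"
      have "(\<lambda>i. \<Sum>n\<in>{-int N..int N}. fc (S i) n * cis (of_int n * t0)) \<longlonglongrightarrow> (\<Sum>n\<in>{-int N..int N}. c n * cis (of_int n * t0))"
        by (intro tendsto_intros c)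
      moreover have "norm (\<Sum>n\<in>{-int N..int N}. fc (S i) n * cis (of_int n * t0)) \<le> \<epsilon> / 2" if "i \<ge> j" for i
      proof -
        have "norm (\<Sum>n\<in>{-int N..int N}. fc (S i) n * cis (of_int n * t0)) \<le> norm (g i (int N)) + norm (g i (- int N - 1))"
          using j(1) that by (intro part) simp
        moreover have "norm (g i (int N)) \<le> \<epsilon> / 4" "norm (g i (- int N - 1)) \<le> \<epsilon> / 4"
          using N by (intro gi[OF that]; simp)+
        ultimately show ?thesis by linarith
      qed
      then have "\<forall>\<^sub>F i in sequentially. norm (\<Sum>n\<in>{-int N..int N}. fc (S i) n * cis (of_int n * t0)) \<le> \<epsilon> / 2"
        unfolding eventually_sequentially by blast
      ultimately have "norm (\<Sum>n\<in>{-int N..int N}. c n * cis (of_int n * t0)) \<le> \<epsilon> / 2"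
        by (intro Lim_norm_ubound[OF sequentially_bot])
      then show "norm ((\<Sum>n\<in>{-int N..int N}. c n * cis (of_int n * t0)) - 0) < \<epsilon>" using \<epsilon> by simp
    qed
  qed
qed

section \<open>Vanishing near almost every point\<close>

lemma interior_zeros_shift:
  assumes "periodic S" "t + 2 * pi * of_int k \<in> interior {t. S t = 0}"
  shows "t \<in> interior {t. S t = 0}"
proof -
  obtain e where e: "e > 0" "ball (t + 2 * pi * of_int k) e \<subseteq> {t. S t = 0}"
    using assms(2) by (auto simp: mem_interior)
  have "ball t e \<subseteq> {t. S t = 0}"
  proof
    fix u assume "u \<in> ball t e"
    then have "u + 2 * pi * of_int k \<in> ball (t + 2 * pi * of_int k) e" by (simp add: dist_real_def)
    then have "S (u + 2 * pi * of_int k) = 0" using e(2) by blast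
    then show "u \<in> {t. S t = 0}" using periodic_int[OF assms(1)] by simp
  qed
  then show ?thesis using e(1) by (auto simp: mem_interior)
qed

text \<open>If the common part of all supports had measure \<open>m > 0\<close> in a period, stage
  \<open>j\<close> would remove at least a fixed multiple of \<open>m / (j + 1)\<close>. The
  harmonic series would then be bounded by the finite initial measure.\<close>

lemma ae_in_interior_zeros:
  assumes S: "\<And>j. periodic (S j)"
    and r: "\<And>j. support_measure (S (Suc j)) \<le> (1 - 1 / (80 * real (12 * j + 1))) * support_measure (S j)"
  shows "AE t in lborel. \<exists>j. t \<in> interior {t. S j t = 0}"
proof -
  define B where "B = (\<Inter>j. - interior {t. S j t = 0})"
  define m where "m = measure lebesgue (B \<inter> {0..2 * pi})"
  have cB: "closed B" unfolding B_def by (intro closed_INT) auto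
  then have "compact (B \<inter> {0..2 * pi})" by (intro closed_Int_compact) auto
  then have lB: "B \<inter> {0..2 * pi} \<in> lmeasurable" by (rule lmeasurable_compact)
  have m0: "m \<ge> 0" by (simp add: m_def)
  have mr: "m \<le> support_measure (S j)" for j
    unfolding m_def support_measure_def
    using lB by (intro measure_mono_fmeasurable lmeasurable_support) (auto simp: B_def dest: fmeasurableD)
  have "m = 0"
  proof (rule ccontr)
    assume "m \<noteq> 0"
    then have m: "m > 0" using m0 by simp
    \<comment> \<open>Here \<open>12 j + 1\<close> is bounded by \<open>12 (j + 1)\<close>, and 960
      is 80 times 12.\<close>
    have dec: "m / 960 * inverse (real (Suc j)) \<le> support_measure (S j) - support_measure (S (Suc j))" for j
    proof -
      have "m * (1 / (960 * real (Suc j))) \<le> support_measure (S j) * (1 / (80 * real (12 * j + 1)))"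
      proof (rule mult_mono)
        show "1 / (960 * real (Suc j)) \<le> 1 / (80 * real (12 * j + 1))" by (rule frac_le) auto
      qed (use mr[of j] m in auto)
      then show ?thesis using r[of j] by (simp add: algebra_simps inverse_eq_divide)
    qed
    have "summable (\<lambda>j. m / 960 * inverse (real (Suc j)))"
    proof (rule summableI_nonneg_bounded)
      show "(\<Sum>j<n. m / 960 * inverse (real (Suc j))) \<le> support_measure (S 0)" for n
      proof -
        have "(\<Sum>j<n. m / 960 * inverse (real (Suc j))) \<le> (\<Sum>j<n. support_measure (S j) - support_measure (S (Suc j)))"
          by (intro sum_mono dec)
        also have "\<dots> = support_measure (S 0) - support_measure (S n)" by (rule sum_lessThan_telescope')
        also have "\<dots> \<le> support_measure (S 0)" by (simp add: support_measure_def)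
        finally show ?thesis .
      qed
    qed (use m in simp)
    then have "summable (\<lambda>j. inverse (real (Suc j)))" using m by (simp only: summable_cmult_iff) simp
    then show False using not_summable_harmonic[where 'a = real] summable_Suc_iff[of "\<lambda>n. inverse (real n)"] by simp
  qed
  then have neg: "negligible (B \<inter> {0..2 * pi})" using lB by (simp add: negligible_iff_measure m_def)
  \<comment> \<open>By periodicity \<open>B\<close> is covered by countably many translates of its
    part in one period.\<close>
  have "B \<subseteq> (\<Union>k::int. (+) (2 * pi * of_int k) ` (B \<inter> {0..2 * pi}))"
  proof
    fix t assume t: "t \<in> B"
    obtain k :: int where k: "t - 2 * pi * of_int k \<in> {0..2 * pi}" by (rule ex_shift_into_period)
    have "t - 2 * pi * of_int k \<in> B"
    proof -
      have "t - 2 * pi * of_int k \<notin> interior {t. S j t = 0}" for j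
        using interior_zeros_shift[OF S, of t "- k" j] t by (auto simp: B_def)
      then show ?thesis by (simp add: B_def)
    qed
    then show "t \<in> (\<Union>k::int. (+) (2 * pi * of_int k) ` (B \<inter> {0..2 * pi}))"
      using k by (intro UN_I[of k]) (auto intro!: image_eqI[of _ _ "t - 2 * pi * of_int k"])
  qed
  moreover have "negligible (\<Union>k::int. (+) (2 * pi * of_int k) ` (B \<inter> {0..2 * pi}))"
    by (intro negligible_countable_Union) (auto intro: negligible_translation neg)
  ultimately have "negligible B" by (rule negligible_subset[rotated])
  then have "B \<in> null_sets lborel"
    using cB null_sets_completion_iff[of B lborel] by (simp add: negligible_iff_null_sets borel_closed)
  then show ?thesis by (rule AE_I') (auto simp: B_def)
qed

section \<open>Iteration of the damping step and the limiting coefficients\<close>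

theorem theorem1:
  shows "\<exists>c :: int \<Rightarrow> complex. (\<exists>n. c n \<noteq> 0) \<and> null_series c \<and>
    (\<forall>k::nat. k \<ge> 1 \<longrightarrow>
       (\<exists>C. \<forall>\<^sub>F n in at_bot. norm (c n) \<le> C * \<bar>real_of_int n\<bar> powr (- real k)))"
proof -
  \<comment> \<open>The stage \<open>j\<close> sets both the accuracy \<open>(1/2) ^ j\<close> and
    the order of decay demanded at negative frequencies, so every fixed order is eventually covered.
    The clause for \<open>j = 0\<close> keeps the start available for nontriviality.\<close>
  let ?P = "\<lambda>j S. psmooth S \<and> (j = (0::nat) \<longrightarrow> S = (\<lambda>_. 1))"
  let ?Q = "\<lambda>j S S'. (\<forall>t. S t = 0 \<longrightarrow> S' t = 0) \<and>
    (\<forall>l K n. C1_le l K \<longrightarrow> norm (fc (\<lambda>t. (S' t - S t) * l t) n) \<le> (1/2) ^ j * K) \<and>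
    (\<forall>n<0. \<bar>of_int n\<bar> ^ j * norm (fc (\<lambda>t. S' t - S t) n) \<le> (1/2) ^ j) \<and>
    support_measure S' \<le> (1 - 1 / (80 * real (12 * j + 1))) * support_measure S"
  have "\<exists>S. \<forall>j. ?P j (S j) \<and> ?Q j (S j) (S (Suc j))"
  proof (rule dependent_nat_choice)
    show "\<exists>S. ?P 0 S" using psmooth_const by blast
    fix S and j :: nat
    assume "?P j S"
    then have S: "psmooth S" by simp
    obtain S' where "psmooth S'" "\<And>t. S t = 0 \<Longrightarrow> S' t = 0"
      "\<And>l K n. C1_le l K \<Longrightarrow> norm (fc (\<lambda>t. (S' t - S t) * l t) n) \<le> (1/2) ^ j * K"
      "\<And>n. n < 0 \<Longrightarrow> \<bar>of_int n\<bar> ^ j * norm (fc (\<lambda>t. S' t - S t) n) \<le> (1/2) ^ j"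
      "support_measure S' \<le> (1 - 1 / (80 * real (12 * j + 1))) * support_measure S"
      by (rule damping_step[OF S, of "(1/2) ^ j" j]) auto
    then show "\<exists>S'. ?P (Suc j) S' \<and> ?Q j S S'" by blast
  qed
  then obtain S where PQ: "\<forall>j. ?P j (S j) \<and> ?Q j (S j) (S (Suc j))" by (rule exE)
  have P: "?P j (S j)" for j by (rule conjunct1[OF spec[OF PQ]])
  have Q: "?Q j (S j) (S (Suc j))" for j by (rule conjunct2[OF spec[OF PQ]])
  have S: "\<And>j. psmooth (S j)" and S0: "S 0 = (\<lambda>_. 1)" using P by auto
  have mono: "S (Suc j) t = 0" if "S j t = 0" for j t using Q[of j] that by blast
  have \<Delta>: "norm (fc (\<lambda>t. (S (Suc j) t - S j t) * l t) n) \<le> (1/2) ^ j * K" if "C1_le l K" for j l K n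
    using Q[of j] that by blast
  have neg: "\<bar>of_int n\<bar> ^ j * norm (fc (\<lambda>t. S (Suc j) t - S j t) n) \<le> (1/2) ^ j" if "n < 0" for j n
    using Q[of j] that by blast
  have res: "support_measure (S (Suc j)) \<le> (1 - 1 / (80 * real (12 * j + 1))) * support_measure (S j)" for j
    using Q[of j] by blast
  have cS: "continuous_on UNIV (S j)" for j using S smooth_imp_continuous by (auto simp: psmooth_def)
  have diff: "fc (S (Suc j)) n - fc (S j) n = fc (\<lambda>t. S (Suc j) t - S j t) n" for j n
    using fc_diff[OF cS cS] by simp
  have one: "C1_le (\<lambda>_. 1) 1"
    unfolding C1_le_def periodic_def by (auto intro!: exI[of _ "\<lambda>_. 0"])
  have st: "norm (fc (S (Suc j)) n - fc (S j) n) \<le> 1 * (1/2) ^ j" for j n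
    using \<Delta>[OF one, of j n] unfolding diff by simp
  define c where "c n = lim (\<lambda>j. fc (S j) n)" for n
  have c: "(\<lambda>j. fc (S j) n) \<longlonglongrightarrow> c n" for n
    unfolding c_def using convergent_geometric[of "\<lambda>j. fc (S j) n" 1] st by (simp add: convergent_LIMSEQ_iff)
  have lim_diff: "norm (c n - fc (S j) n) \<le> B" if "\<And>m. norm (fc (S (j + m)) n - fc (S j) n) \<le> B" for n j B
  proof -
    have "(\<lambda>m. fc (S (j + m)) n - fc (S j) n) \<longlonglongrightarrow> c n - fc (S j) n"
      using LIMSEQ_ignore_initial_segment[OF c[of n], of j] by (intro tendsto_intros) (simp add: add.commute)
    then show ?thesis using that by (intro Lim_norm_ubound[OF sequentially_bot]) auto
  qed
  show ?thesis
  proof (intro exI[of _ c] conjI allI impI)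
    \<comment> \<open>The constant 1 has unnormalised zeroth coefficient 2 pi, and all increments
      together are at most 2, so the limit cannot be 0.\<close>
    have "norm (c 0 - fc (S 0) 0) \<le> 2"
      using norm_diff_geometric[of 0 "\<lambda>j. fc (S j) 0" 1 0] st by (intro lim_diff) simp
    moreover have "fc (S 0) 0 = of_real (2 * pi)"
      unfolding S0 fc_def by (simp add: scaleR_conv_of_real)
    ultimately have "norm (c 0 - of_real (2 * pi)) \<le> 2" by simp
    moreover have "norm (0 - complex_of_real (2 * pi)) > 2" using pi_gt3 by simp
    ultimately have "c 0 \<noteq> 0" by (metis not_le)
    then show "\<exists>n. c n \<noteq> 0" by blast
  next
    have "periodic (S j)" for j using S by (simp add: psmooth_def)
    then have "AE t in lborel. \<exists>j. t \<in> interior {t. S j t = 0}"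
      using res by (rule ae_in_interior_zeros)
    then show "null_series c"
      unfolding null_series_def
    proof (rule AE_mp[OF _ AE_I2], intro impI)
      fix t assume "\<exists>j. t \<in> interior {t. S j t = 0}"
      then obtain j where "t \<in> interior {t. S j t = 0}" by blast
      from local_convergence[OF S mono \<Delta> c this]
      show "(\<lambda>N. \<Sum>n\<in>{-int N..int N}. c n * exp (\<i> * of_int n * of_real t)) \<longlonglongrightarrow> 0"
        by (simp add: cis_conv_exp mult.assoc)
    qed
  next
    fix k :: nat
    assume "k \<ge> 1"
    obtain C where C: "C \<ge> 0" "\<And>x p. x \<ge> 0 \<Longrightarrow> \<bar>of_int p\<bar> ^ k * norm (fc (\<lambda>t. S k t * cis (x * sin t)) p) \<le> C * (1 + x) ^ k"
      using fc_phase_decay[OF S, of k k] by blast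
    have "norm (c n) \<le> (C + 2) * \<bar>real_of_int n\<bar> powr (- real k)" if n: "n < 0" for n
    proof -
      define q where "q = \<bar>real_of_int n\<bar>"
      have q: "q \<ge> 1" using n by (simp add: q_def)
      \<comment> \<open>From stage \<open>k\<close> on the demanded order is at least
        \<open>k\<close>, and \<open>q \<ge> 1\<close> permits lowering it to \<open>k\<close>. The
        earlier stages are contained in the smooth function \<open>S k\<close>, whose coefficients
        decay at order \<open>k\<close> by the chirp estimate with \<open>x = 0\<close>.\<close>
      have "norm (fc (S (Suc j)) n - fc (S j) n) \<le> (1 / q ^ k) * (1/2) ^ j" if "j \<ge> k" for j
      proof -
        have "q ^ k * norm (fc (S (Suc j)) n - fc (S j) n) \<le> q ^ j * norm (fc (S (Suc j)) n - fc (S j) n)"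
          using q that by (intro mult_right_mono power_increasing) auto
        also have "\<dots> \<le> (1/2) ^ j" using neg[OF n] unfolding diff q_def .
        finally show ?thesis using q by (simp add: field_simps)
      qed
      from norm_diff_geometric[of k "\<lambda>j. fc (S j) n", OF this order_refl]
      have "norm (c n - fc (S k) n) \<le> 2 * (1 / q ^ k) * (1/2) ^ k" by (rule lim_diff)
      also have "\<dots> \<le> 2 * (1 / q ^ k) * 1" using q by (intro mult_left_mono power_le_one) auto
      finally have "norm (c n - fc (S k) n) \<le> 2 / q ^ k" by simp
      moreover have "norm (fc (S k) n) \<le> C / q ^ k"
        using C(2)[of 0 n] q by (simp add: q_def[symmetric] field_simps)
      ultimately have "norm (c n) \<le> (C + 2) / q ^ k"
        using norm_triangle_ineq[of "c n - fc (S k) n" "fc (S k) n"] by (simp add: add_divide_distrib)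
      also have "\<dots> = (C + 2) * q powr (- real k)"
        using q by (simp add: powr_minus powr_realpow divide_inverse)
      finally show ?thesis by (simp add: q_def)
    qed
    then have "\<forall>\<^sub>F n in at_bot. norm (c n) \<le> (C + 2) * \<bar>real_of_int n\<bar> powr (- real k)"
      unfolding eventually_at_bot_linorder by (intro exI[of _ "-1"]) auto
    then show "\<exists>C. \<forall>\<^sub>F n in at_bot. norm (c n) \<le> C * \<bar>real_of_int n\<bar> powr (- real k)" by blast
  qed
qed

end
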